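(* Let $p$ be a prime and let $G$ be a finite $p$-group such that $G_3\cong C_p$, $\Phi(G')=1$ and $G/G_3\cong M_p(n,m,1)$, where $n\ge m$, and $n>1$ if $p=2$. Let $w(G)=(w_{ij})$ be a characteristic matrix of $G$. Then: (1) If $p=2$ and $m=1$, then $G\in\mathcal{A}_3$. (2) Suppose that $m>1$ in case $p=2$. If $w_{22}=0$ and $w_{12}\ne0$, then $G\in\mathcal{A}_{m+1}$. (3) Suppose that $m>1$ in case $p=2$. If $w_{22}\ne0$ and $w_{12}=0$, then $G\in\mathcal{A}_{n+1}$.
   Context: All groups are finite $p$-groups; $G_3=[G',G]$, $\Phi(H)$ is the Frattini subgroup of $H$, $[x,y]=x^{-1}y^{-1}xy$. For a positive integer $t$, $G\in\mathcal{A}_t$ means that $G$ is a non-abelian $p$-group and the maximal index in $G$ of the minimal non-abelian subgroups of $G$ is $p^{t-1}$. For $n\ge m\ge 1$ (with $n>1$ if $p=2$), $M_p(n,m,1)=\langle a,b,c\mid a^{p^n}=b^{p^m}=c^p=1,\ [a,b]=c,\ [c,a]=[c,b]=1\rangle$. Characteristic matrix: choose $a,b\in G$ whose images $\tilde a,\tilde b$ in $G/G_3\cong M_p(n,m,1)$ are generators satisfying, with $\tilde c=[\tilde a,\tilde b]$, the relations $\tilde a^{p^n}=\tilde b^{p^m}=\tilde c^p=1$, $[\tilde c,\tilde a]=[\tilde c,\tilde b]=1$ (image of $a$ of order $p^n$, image of $b$ of order $p^m$), put $c=[a,b]$ (so $c^p=1$), and let $G_3=\langle z\rangle$. Then there are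 $w_{ij}\in F_p$ (the field with $p$ elements) with $a^{p^n}=z^{w_{11}}$, $b^{p^m}=z^{w_{21}}$, $[c,a]=z^{w_{12}}$, $[c,b]=z^{w_{22}}$. The $2\times2$ matrix $w(G)=(w_{ij})$ over $F_p$ is called a characteristic matrix of $G$ (it depends on the choices). *)

theory Defs
  imports
    "HOL-Algebra.Algebra"
    "HOL-Number_Theory.Residues"
    "HOL-Analysis.Finite_Cartesian_Product"
begin

section \<open>Group presentations\<close>

text \<open>
  Words in the generators and their formal inverses: the letter \<open>(x, True)\<close> stands for
  \<open>x\<close> and \<open>(x, False)\<close> for the inverse of \<open>x\<close>.
\<close>

type_synonym 'x gword = "('x \<times> bool) list"

definition gword_inv :: "'x gword \<Rightarrow> 'x gword" where
  "gword_inv u = rev (map (\<lambda>(x, e). (x, \<not> e)) u)"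

definition gword_pow :: "'x gword \<Rightarrow> nat \<Rightarrow> 'x gword" where
  "gword_pow u k = concat (replicate k u)"

definition gword_comm :: "'x gword \<Rightarrow> 'x gword \<Rightarrow> 'x gword" where
  "gword_comm u v = gword_inv u @ gword_inv v @ u @ v"

inductive pres_eq :: "('x gword \<times> 'x gword) set \<Rightarrow> 'x gword \<Rightarrow> 'x gword \<Rightarrow> bool" for R where
  refl: "pres_eq R u u"
| sym: "pres_eq R u v \<Longrightarrow> pres_eq R v u"
| trans: "pres_eq R u v \<Longrightarrow> pres_eq R v w \<Longrightarrow> pres_eq R u w"
| cancel: "pres_eq R (u @ [(x, e), (x, \<not> e)] @ v) (u @ v)"
| rel: "(l, r) \<in> R \<Longrightarrow> pres_eq R (u @ l @ v) (u @ r @ v)"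

text \<open>
  The group generated by all elements of the type \<open>'x\<close>, subject to the relations
  \<open>l = r\<close> for \<open>(l, r) \<in> R\<close>.
\<close>

definition presented_group :: "('x gword \<times> 'x gword) set \<Rightarrow> 'x gword set monoid" where
  "presented_group R =
     \<lparr>carrier = UNIV // {(u, v). pres_eq R u v},
      monoid.mult = (\<lambda>U V. {w. \<exists>u\<in>U. \<exists>v\<in>V. pres_eq R (u @ v) w}),
      one = {w. pres_eq R [] w}\<rparr>"

datatype Mp_gen = Gen_a | Gen_b | Gen_c

definition Mp_relations :: "nat \<Rightarrow> nat \<Rightarrow> nat \<Rightarrow> (Mp_gen gword \<times> Mp_gen gword) set" where
  "Mp_relations p n m =
     (let a = [(Gen_a, True)]; b = [(Gen_b, True)]; c = [(Gen_c, True)] in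
      {(gword_pow a (p ^ n), []), (gword_pow b (p ^ m), []), (gword_pow c p, []),
       (gword_comm a b, c), (gword_comm c a, []), (gword_comm c b, [])})"

text \<open>The group \<open>M\<^sub>p(n, m, 1)\<close>.\<close>

definition Mp_group :: "nat \<Rightarrow> nat \<Rightarrow> nat \<Rightarrow> Mp_gen gword set monoid" where
  "Mp_group p n m = presented_group (Mp_relations p n m)"

section \<open>Commutators, Frattini subgroup, the classes \<open>A\<^sub>t\<close>\<close>

definition p_group :: "nat \<Rightarrow> ('g, 'x) monoid_scheme \<Rightarrow> bool" where
  "p_group p G \<longleftrightarrow> group G \<and> finite (carrier G) \<and> (\<exists>k. order G = p ^ k)"

definition commutator :: "('g, 'x) monoid_scheme \<Rightarrow> 'g \<Rightarrow> 'g \<Rightarrow> 'g" where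
  "commutator G x y = inv\<^bsub>G\<^esub> x \<otimes>\<^bsub>G\<^esub> inv\<^bsub>G\<^esub> y \<otimes>\<^bsub>G\<^esub> x \<otimes>\<^bsub>G\<^esub> y"

definition commutator_subgroup :: "('g, 'x) monoid_scheme \<Rightarrow> 'g set \<Rightarrow> 'g set \<Rightarrow> 'g set" where
  "commutator_subgroup G H K = generate G {commutator G x y | x y. x \<in> H \<and> y \<in> K}"

text \<open>
  The library constant \<^const>\<open>derived\<close> uses the commutators \<open>x y x\<inverse> y\<inverse>\<close>. For the whole
  group the set of these commutators is the same as the one for \<open>x\<inverse> y\<inverse> x y\<close>.
\<close>

definition G3 :: "('g, 'x) monoid_scheme \<Rightarrow> 'g set" where
  "G3 G = commutator_subgroup G (derived G (carrier G)) (carrier G)"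

definition maximal_subgroup :: "'g set \<Rightarrow> ('g, 'x) monoid_scheme \<Rightarrow> bool" where
  "maximal_subgroup M G \<longleftrightarrow>
     subgroup M G \<and> M \<noteq> carrier G \<and>
     (\<forall>K. subgroup K G \<and> M \<subseteq> K \<longrightarrow> K = M \<or> K = carrier G)"

text \<open>
  Intersecting with the carrier makes the trivial group, which has no maximal subgroups,
  its own Frattini subgroup.
\<close>

definition frattini :: "('g, 'x) monoid_scheme \<Rightarrow> 'g set" where
  "frattini G = carrier G \<inter> \<Inter> {M. maximal_subgroup M G}"

definition minimal_nonabelian :: "('g, 'x) monoid_scheme \<Rightarrow> bool" where
  "minimal_nonabelian G \<longleftrightarrow>
     group G \<and> \<not> comm_group G \<and>
     (\<forall>H. subgroup H G \<and> H \<noteq> carrier G \<longrightarrow> comm_group (G\<lparr>carrier := H\<rparr>))"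

text \<open>A finite non-abelian group has minimal non-abelian subgroups, so the maximum is over
  a finite nonempty set.\<close>

definition class_A :: "nat \<Rightarrow> nat \<Rightarrow> ('g, 'x) monoid_scheme \<Rightarrow> bool" where
  "class_A p t G \<longleftrightarrow>
     t \<ge> 1 \<and> p_group p G \<and> \<not> comm_group G \<and>
     Max {card (rcosets\<^bsub>G\<^esub> H) | H. subgroup H G \<and> minimal_nonabelian (G\<lparr>carrier := H\<rparr>)}
       = p ^ (t - 1)"

section \<open>Characteristic matrices\<close>

text \<open>
  The field with \<open>p\<close> elements is \<^term>\<open>residue_ring (int p)\<close>, with carrier
  \<open>{0..p - 1}\<close>, and the entry \<open>w\<^sub>i\<^sub>j\<close> is \<open>w $ i $ j\<close>.
\<close>

definition characteristic_matrix ::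
  "nat \<Rightarrow> nat \<Rightarrow> nat \<Rightarrow> ('g, 'x) monoid_scheme \<Rightarrow> int ^ 2 ^ 2 \<Rightarrow> bool" where
  "characteristic_matrix p n m G w \<longleftrightarrow>
     (\<exists>a\<in>carrier G. \<exists>b\<in>carrier G. \<exists>z\<in>carrier G.
        let Q = G Mod G3 G;
            a' = G3 G #>\<^bsub>G\<^esub> a;
            b' = G3 G #>\<^bsub>G\<^esub> b;
            c' = commutator Q a' b';
            c = commutator G a b
        in
          generate Q {a', b'} = carrier Q \<and>
          a' [^]\<^bsub>Q\<^esub> (p ^ n) = \<one>\<^bsub>Q\<^esub> \<and> b' [^]\<^bsub>Q\<^esub> (p ^ m) = \<one>\<^bsub>Q\<^esub> \<and> c' [^]\<^bsub>Q\<^esub> p = \<one>\<^bsub>Q\<^esub> \<and>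
          commutator Q c' a' = \<one>\<^bsub>Q\<^esub> \<and> commutator Q c' b' = \<one>\<^bsub>Q\<^esub> \<and>
          group.ord Q a' = p ^ n \<and> group.ord Q b' = p ^ m \<and>
          G3 G = generate G {z} \<and>
          (\<forall>i j. w $ i $ j \<in> carrier (residue_ring (int p))) \<and>
          a [^]\<^bsub>G\<^esub> (p ^ n) = z [^]\<^bsub>G\<^esub> (w $ 1 $ 1) \<and>
          b [^]\<^bsub>G\<^esub> (p ^ m) = z [^]\<^bsub>G\<^esub> (w $ 2 $ 1) \<and>
          commutator G c a = z [^]\<^bsub>G\<^esub> (w $ 1 $ 2) \<and>
          commutator G c b = z [^]\<^bsub>G\<^esub> (w $ 2 $ 2))"

end

theory Submission
  imports Defs
begin

text \<open>
  Put \<open>c = [a, b]\<close>, let \<open>G\<^sub>3 = \<langle>z\<rangle>\<close>, and let \<open>D = \<langle>c, z\<rangle> = G'\<close>, which is elementary abelian of order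
  \<open>p\<^sup>2\<close>. In a finite group a non-abelian subgroup of least possible order is minimal non-abelian, so
  everything reduces to finding the least order of a non-abelian subgroup \<open>H\<close>. By symmetry let \<open>c\<close> commute
  with \<open>b\<close> but not with \<open>a\<close>, where \<open>a\<close> and \<open>b\<close> have order \<open>p ^ \<alpha>\<close> and \<open>p ^ \<beta>\<close> modulo \<open>D\<close>.
  Let \<open>M = \<langle>a ^ p, b, c, z\<rangle>\<close> be the centralizer of \<open>D\<close>.

  If \<open>H\<close> contains some \<open>x\<close> outside \<open>M\<close>, then \<open>x\<close> has order at least \<open>p ^ \<alpha>\<close> modulo \<open>D\<close>. Either \<open>D \<le> H\<close>, or
  \<open>H \<inter> D = \<langle>z\<rangle>\<close> and the abelian group \<open>\<langle>x, z\<rangle>\<close> is properly contained in \<open>H\<close>; in both cases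
  \<open>|H| \<ge> p ^ (\<alpha> + 2)\<close>. If \<open>H \<le> M\<close>, then \<open>M\<close> is non-abelian, which happens only for \<open>p = 2\<close>; then \<open>H D = M\<close> and
  \<open>H \<inter> D \<noteq> 1\<close>, so \<open>|H| \<ge> 2 ^ (\<alpha> + \<beta>)\<close>. The subgroups \<open>\<langle>a, c\<rangle>\<close> and, for \<open>p = 2\<close> and \<open>\<beta> = 1\<close>, \<open>\<langle>a\<^sup>2, b\<rangle>\<close>
  attain these bounds. If \<open>p = 2\<close> and \<open>m = 1\<close>, then \<open>b\<^sup>2\<close> is central, which forces \<open>c\<close> and \<open>b\<close> to commute.
\<close>

section \<open>Powers in groups and minimal non-abelian subgroups\<close>

lemma (in group) m_inv_cancel [simp]:
  assumes "x \<in> carrier G" "y \<in> carrier G"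
  shows "x \<otimes> (inv x \<otimes> y) = y" "inv x \<otimes> (x \<otimes> y) = y"
  using assms by (simp_all flip: m_assoc)

lemma (in monoid) mult_mult_swap:
  assumes "x \<in> carrier G" "y \<in> carrier G" "u \<in> carrier G" "v \<in> carrier G"
    and "y \<otimes> u = u \<otimes> y"
  shows "x \<otimes> y \<otimes> (u \<otimes> v) = x \<otimes> u \<otimes> (y \<otimes> v)"
  using assms by (metis m_assoc m_closed)

lemma (in group) int_pow_conj:
  assumes "x \<in> carrier G" "y \<in> carrier G"
  shows "(inv y \<otimes> x \<otimes> y) [^] (i::int) = inv y \<otimes> x [^] i \<otimes> y"
proof -
  have "(\<lambda>x. inv y \<otimes> x \<otimes> y) \<in> hom G G"
    using assms by (auto simp: hom_def m_assoc)
  from hom_int_pow[OF this assms(1) is_group is_group, of i] show ?thesis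
    by simp
qed

text \<open>Conjugation by \<open>y\<close> is a homomorphism taking \<open>x\<close> to
  \<open>x \<otimes> v\<close>; as \<open>x\<close> and \<open>v\<close> commute, the power of the
  product splits.\<close>

lemma (in group) int_pow_mult_central:
  assumes "x \<in> carrier G" "y \<in> carrier G" "v \<in> carrier G"
    and "x \<otimes> v = v \<otimes> x" and "x \<otimes> y = y \<otimes> x \<otimes> v"
  shows "x [^] (i::int) \<otimes> y = y \<otimes> x [^] i \<otimes> v [^] i"
proof -
  have "inv y \<otimes> x \<otimes> y = x \<otimes> v"
    using assms by (simp add: m_assoc inv_solve_left')
  then have "inv y \<otimes> x [^] i \<otimes> y = x [^] i \<otimes> v [^] i"
    using int_pow_conj[OF assms(1,2)] int_pow_mult_distrib assms by metis
  then show ?thesis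
    using assms by (simp add: m_assoc inv_solve_left')
qed

text \<open>Commutators with a central value are bilinear: the one-sided rule is applied to
  \<open>x\<close>, then to \<open>y\<close> with the roles exchanged, which inverts the
  commutator.\<close>

lemma (in group) int_pow_swap_central:
  assumes x: "x \<in> carrier G" and y: "y \<in> carrier G" and v: "v \<in> carrier G"
    and central: "\<And>g. g \<in> carrier G \<Longrightarrow> g \<otimes> v = v \<otimes> g" and "x \<otimes> y = y \<otimes> x \<otimes> v"
  shows "x [^] (i::int) \<otimes> y [^] (j::int) = y [^] j \<otimes> x [^] i \<otimes> v [^] (i * j)"
proof -
  let ?x = "x [^] i" and ?w = "v [^] i"
  have cw: "g \<otimes> v [^] k = v [^] k \<otimes> g" if "g \<in> carrier G" for g and k :: int
    using int_pow_mult_central[of v g \<one> k] that v central by simp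
  have "?x \<otimes> y = y \<otimes> ?x \<otimes> ?w"
    using int_pow_mult_central[OF x y v _ assms(5)] central x by blast
  then have "y \<otimes> ?x = ?x \<otimes> y \<otimes> inv (v [^] i)"
    using x y v by (simp add: inv_solve_right)
  then have "y [^] j \<otimes> ?x = ?x \<otimes> y [^] j \<otimes> (v [^] (- i)) [^] j"
    using int_pow_mult_central[of y ?x "v [^] (- i)" j] x y v cw[of y "- i"]
    by (simp add: int_pow_neg)
  then have "y [^] j \<otimes> ?x \<otimes> v [^] (i * j) = ?x \<otimes> y [^] j \<otimes> (v [^] (- (i * j)) \<otimes> v [^] (i * j))"
    using x y v by (simp add: int_pow_pow m_assoc)
  then show ?thesis
    using x y v by (simp add: int_pow_neg)
qed

lemma (in group) int_pow_commute:
  assumes "x \<in> carrier G" "y \<in> carrier G" "x \<otimes> y = y \<otimes> x"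
  shows "x [^] (i::int) \<otimes> y [^] (j::int) = y [^] j \<otimes> x [^] i"
  using int_pow_swap_central[of x y \<one> i j] assms by simp

lemma (in group) int_pow_mod:
  assumes "x \<in> carrier G" "x [^] (n::nat) = \<one>"
  shows "x [^] (k mod int n) = x [^] (k::int)"
proof -
  have "x [^] k = x [^] (int n * (k div int n) + k mod int n)"
    by simp
  also have "\<dots> = (x [^] int n) [^] (k div int n) \<otimes> x [^] (k mod int n)"
    by (metis assms(1) int_pow_mult int_pow_pow)
  finally show ?thesis using assms by (simp add: int_pow_int)
qed

text \<open>An inverse of \<open>l\<close> modulo \<open>n\<close> turns \<open>x [^] l\<close> back
  into \<open>x\<close>; any exponent \<open>n\<close> that kills \<open>x\<close> will do.\<close>

lemma (in group) mem_subgroup_of_coprime_pow: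
  assumes H: "subgroup H G" and x: "x \<in> carrier G" "x [^] (n::nat) = \<one>"
    and "coprime (l::int) (int n)" "x [^] l \<in> H"
  shows "x \<in> H"
proof -
  obtain u where u: "[l * u = 1] (mod int n)"
    using cong_solve_coprime_int assms(4) by blast
  have "x [^] (l * u) = x [^] (1::int)"
    using u int_pow_mod[OF x] by (metis cong_def)
  then have "x = (x [^] l) [^] u"
    using x by (simp add: int_pow_pow)
  then show ?thesis
    using subgroup_int_pow_closed[OF H assms(5)] by metis
qed

lemma (in group) commuting_pows_mult:
  assumes "x \<in> carrier G" "y \<in> carrier G" "x \<otimes> y = y \<otimes> x"
  shows "x [^] (i::int) \<otimes> y [^] (j::int) \<otimes> (x [^] (k::int) \<otimes> y [^] (l::int)) = x [^] (i + k) \<otimes> y [^] (j + l)"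
  using mult_mult_swap[of "x [^] i" "y [^] j" "x [^] k" "y [^] l"] int_pow_commute[of x y k j] assms
  by (simp add: int_pow_mult)

lemma (in group) commuting_pows_pow:
  assumes "x \<in> carrier G" "y \<in> carrier G" "x \<otimes> y = y \<otimes> x"
  shows "(x [^] (i::int) \<otimes> y [^] (j::int)) [^] (r::int) = x [^] (r * i) \<otimes> y [^] (r * j)"
  using int_pow_mult_distrib[of "x [^] i" "y [^] j" r] int_pow_commute[of x y i j] assms
  by (simp add: int_pow_pow mult.commute)

section \<open>Least orders of non-abelian subgroups\<close>

lemma (in group) card_subgroup_p_power:
  assumes "Factorial_Ring.prime p" "order G = p ^ k" "finite (carrier G)" "subgroup H G"
  obtains h where "card H = p ^ h"
proof -
  have "card H dvd p ^ k"
    using lagrange[OF assms(4)] assms(2) by (metis dvd_triv_right)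
  then show ?thesis
    using divides_primepow_nat[OF assms(1)] that by blast
qed

text \<open>\<open>S\<close> attains the least order \<open>p ^ s\<close>, so its proper subgroups
  are abelian. By Lagrange the lower bound on orders becomes the upper bound \<open>p ^ t\<close> on
  indices.\<close>

lemma (in group) class_A_of_minimal_order:
  assumes p: "Factorial_Ring.prime p" and "finite (carrier G)" and "order G = p ^ (s + t)"
    and lower: "\<And>H. subgroup H G \<Longrightarrow> \<exists>x\<in>H. \<exists>y\<in>H. x \<otimes> y \<noteq> y \<otimes> x \<Longrightarrow> p ^ s \<le> card H"
    and S: "subgroup S G" "card S \<le> p ^ s" "\<exists>x\<in>S. \<exists>y\<in>S. x \<otimes> y \<noteq> y \<otimes> x"
  shows "class_A p (t + 1) G"
proof -
  have p0: "p > 0" "p \<noteq> 0" using p prime_gt_0_nat by auto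
  have comm: "comm_group (G\<lparr>carrier := H\<rparr>)  \<longleftrightarrow> \<not> (\<exists>x\<in>H. \<exists>y\<in>H. x \<otimes> y \<noteq> y \<otimes> x)"
    if "subgroup H G" for H
    using subgroup_imp_group[OF that] group.group_comm_groupI[of "G\<lparr>carrier := H\<rparr>"]
      comm_monoid.m_comm[of "G\<lparr>carrier := H\<rparr>"] comm_group.axioms(1) by fastforce
  have nab: "\<not> comm_group G"
    using comm[OF subgroup_self] S subgroup.subset[OF S(1)] by auto
  have cS: "card S = p ^ s"
    using lower[OF S(1,3)] S(2) by simp
  have "comm_group (G\<lparr>carrier := H\<rparr>)" if H: "subgroup H (G\<lparr>carrier := S\<rparr>)" "H \<noteq> S" for H
  proof (rule ccontr)
    assume n: "\<not> comm_group (G\<lparr>carrier := H\<rparr>)"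
    have HG: "subgroup H G" using H incl_subgroup[OF S(1)] by blast
    have "finite S" using finite_subset[OF subgroup.subset[OF S(1)]] assms by blast
    moreover have "H \<subset> S" using subgroup.subset[OF H(1)] H(2) by auto
    ultimately have "card H < card S" by (rule psubset_card_mono)
    with lower[OF HG] n comm[OF HG] cS show False by auto
  qed
  then have minS: "minimal_nonabelian (G\<lparr>carrier := S\<rparr>)"
    using comm[OF S(1)] S(3) subgroup_imp_group[OF S(1)] by (auto simp: minimal_nonabelian_def)
  have "Max {card (rcosets H) | H. subgroup H G \<and> minimal_nonabelian (G\<lparr>carrier := H\<rparr>)} = p ^ t"
  proof (rule Max_eqI)
    show "finite {card (rcosets H) |H. subgroup H G \<and> minimal_nonabelian (G\<lparr>carrier := H\<rparr>)}"
    proof (rule finite_subset)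
      show "{card (rcosets H) |H. subgroup H G \<and> minimal_nonabelian (G\<lparr>carrier := H\<rparr>)}
            \<subseteq> (\<lambda>H. card (rcosets H)) ` Pow (carrier G)"
        using subgroup.subset by blast
    qed (use assms in auto)
  next
    fix y assume "y \<in> {card (rcosets H) |H. subgroup H G \<and> minimal_nonabelian (G\<lparr>carrier := H\<rparr>)}"
    then obtain H where H: "y = card (rcosets H)" "subgroup H G" "minimal_nonabelian (G\<lparr>carrier := H\<rparr>)"
      by blast
    have "p ^ s \<le> card H"
      using lower H comm minimal_nonabelian_def by blast
    then have "y * p ^ s \<le> p ^ s * p ^ t"
      using lagrange[OF H(2)] H(1) assms(3) by (metis mult_le_mono2 power_add)
    then show "y \<le> p ^ t" using p0 by simp
  next
    have "card (rcosets S) * p ^ s = p ^ s * p ^ t"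
      using lagrange[OF S(1)] cS assms(3) by (simp add: power_add)
    then have "card (rcosets S) = p ^ t" using p0 by simp
    then show "p ^ t \<in> {card (rcosets H) |H. subgroup H G \<and> minimal_nonabelian (G\<lparr>carrier := H\<rparr>)}"
      using S(1) minS by (metis (mono_tags, lifting) mem_Collect_eq)
  qed
  then show ?thesis
    using nab assms is_group by (auto simp: class_A_def p_group_def)
qed

section \<open>Normal forms\<close>

text \<open>One setting for both cases: in the second one \<open>a\<close> and \<open>b\<close> are
  exchanged together with their exponents. The element \<open>z\<close> is normalised to be the
  commutator of \<open>c\<close> and \<open>a\<close>.\<close>

locale class3_group = group G for G (structure) +
  fixes a b c z and p \<alpha> \<beta> :: nat
  assumes fin: "finite (carrier G)"
    and p: "Factorial_Ring.prime p"
    and closed [simp]: "a \<in> carrier G" "b \<in> carrier G" "c \<in> carrier G" "z \<in> carrier G"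
    and ab: "a \<otimes> b = b \<otimes> a \<otimes> c"
    and ca: "c \<otimes> a = a \<otimes> c \<otimes> z"
    and cb: "c \<otimes> b = b \<otimes> c"
    and z_central: "\<And>g. g \<in> carrier G \<Longrightarrow> g \<otimes> z = z \<otimes> g"
    and z_ne: "z \<noteq> \<one>"
    and z_p: "z [^] p = \<one>"
    and c_p: "c [^] p = \<one>"
    and a_pow: "\<exists>e::int. a [^] (p ^ \<alpha>) = z [^] e"
    and b_pow: "\<exists>e::int. b [^] (p ^ \<beta>) = z [^] e"
    and gen: "\<And>K. subgroup K G \<Longrightarrow> a \<in> K \<Longrightarrow> b \<in> K \<Longrightarrow> z \<in> K \<Longrightarrow> K = carrier G"
    and order_ge: "p ^ (\<alpha> + \<beta> + 2) \<le> order G"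
begin

lemma p_pos: "p > 0"
  using p prime_gt_0_nat by blast

lemma p_int: "Factorial_Ring.prime (int p)"
  using p by simp

lemma z_pow_central: "g \<in> carrier G \<Longrightarrow> g \<otimes> z [^] (k::int) = z [^] k \<otimes> g"
  using int_pow_mult_central[of z g \<one> k] z_central by simp

lemma z_pow_eq_one: "z [^] (l::int) = \<one> \<longleftrightarrow> int p dvd l"
proof -
  have "ord z dvd p" using z_p by (simp add: pow_eq_id)
  moreover have "ord z \<noteq> 1" using z_ne ord_eq_1 by simp
  ultimately have "ord z = p" using p prime_nat_iff by blast
  then show ?thesis by (simp add: int_pow_eq_id)
qed

lemma c_a_pow: "c [^] (k::int) \<otimes> a [^] (i::int) = a [^] i \<otimes> c [^] k \<otimes> z [^] (k * i)"
  by (rule int_pow_swap_central) (simp_all add: z_central ca)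

lemma c_b_pow: "c [^] (k::int) \<otimes> b [^] (j::int) = b [^] j \<otimes> c [^] k"
  by (rule int_pow_commute) (simp_all add: cb)

section \<open>Normal forms and the normal subgroup \<open>D\<close>\<close>

definition nf :: "int \<Rightarrow> int \<Rightarrow> int \<Rightarrow> int \<Rightarrow> 'a" where
  "nf i j k l = a [^] i \<otimes> b [^] j \<otimes> c [^] k \<otimes> z [^] l"

lemma nf_closed [simp]: "nf i j k l \<in> carrier G"
  by (simp add: nf_def)

definition D :: "'a set" where
  "D = {nf 0 0 k l | k l. True}"

lemma nf_zero: "nf 0 0 k l = c [^] k \<otimes> z [^] l"
  by (simp add: nf_def)

lemma D_mult: "nf 0 0 k l \<otimes> nf 0 0 k' l' = nf 0 0 (k + k') (l + l')"
  unfolding nf_zero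
  using mult_mult_swap[of "c [^] k" "z [^] l" "c [^] k'" "z [^] l'"] z_pow_central[of "c [^] k'" l]
  by (simp add: int_pow_mult)

lemma nf_D: "nf i j k l = a [^] i \<otimes> b [^] j \<otimes> nf 0 0 k l"
  by (simp add: nf_def m_assoc)

lemma nf_D_mult: "nf i j k l \<otimes> nf 0 0 k' l' = nf i j (k + k') (l + l')"
  using D_mult[of k l k' l'] by (simp add: nf_D[of i j] m_assoc)

lemma D_a: "nf 0 0 k l \<otimes> a [^] i = a [^] i \<otimes> nf 0 0 k (l + k * i)"
proof -
  have "nf 0 0 k l \<otimes> a [^] i = z [^] l \<otimes> (c [^] k \<otimes> a [^] i)"
    unfolding nf_zero z_pow_central[of "c [^] k" l, simplified] by (simp add: m_assoc)
  also have "\<dots> = a [^] i \<otimes> c [^] k \<otimes> z [^] (k * i) \<otimes> z [^] l"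
    unfolding c_a_pow by (simp add: z_pow_central[of "a [^] i \<otimes> c [^] k \<otimes> z [^] (k * i)" l])
  also have "\<dots> = a [^] i \<otimes> nf 0 0 k (l + k * i)"
    by (simp add: nf_zero m_assoc add.commute flip: int_pow_mult)
  finally show ?thesis .
qed

lemma D_b: "nf 0 0 k l \<otimes> b [^] (j::int) = b [^] j \<otimes> nf 0 0 k l"
proof -
  have "nf 0 0 k l \<otimes> b [^] (j::int) = z [^] l \<otimes> (c [^] k \<otimes> b [^] j)"
    unfolding nf_zero z_pow_central[of "c [^] k" l, simplified] by (simp add: m_assoc)
  also have "\<dots> = b [^] j \<otimes> c [^] k \<otimes> z [^] l"
    unfolding c_b_pow by (simp add: z_pow_central[of "b [^] j \<otimes> c [^] k" l])
  finally show ?thesis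
    by (simp add: nf_zero m_assoc)
qed

lemma nf_in_D: "nf 0 0 k l \<in> D"
  by (auto simp: D_def)

lemma D_subgroup: "subgroup D G"
proof (rule subgroupI)
  show "D \<subseteq> carrier G" "D \<noteq> {}" by (auto simp: D_def)
next
  fix x assume "x \<in> D"
  then obtain k l where x: "x = nf 0 0 k l" by (auto simp: D_def)
  have "nf 0 0 k l \<otimes> nf 0 0 (-k) (-l) = \<one>"
    unfolding D_mult by (simp add: nf_def)
  then have "inv x = nf 0 0 (-k) (-l)"
    using x by (metis inv_equality inv_inv nf_closed)
  then show "inv x \<in> D" by (auto simp: D_def)
next
  fix x y assume "x \<in> D" "y \<in> D"
  then show "x \<otimes> y \<in> D" using D_mult by (fastforce simp: D_def)
qed

lemma D_carrier: "d \<in> D \<Longrightarrow> d \<in> carrier G"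
  by (auto simp: D_def)

text \<open>The elements normalizing \<open>D\<close> form a subgroup containing the generators.
  \<open>K\<close> asks for conjugation by both \<open>x\<close> and \<open>inv x\<close>, so that
  closure under inverses is immediate.\<close>

lemma D_normal: "D \<lhd> G"
proof -
  define K where "K = {x \<in> carrier G. \<forall>d\<in>D. x \<otimes> d \<otimes> inv x \<in> D \<and> inv x \<otimes> d \<otimes> x \<in> D}"
  have "subgroup K G"
  proof (rule subgroupI)
    show "K \<subseteq> carrier G" by (auto simp: K_def)
    show "K \<noteq> {}" using D_carrier by (auto simp: K_def intro!: exI[of _ \<one>])
    fix x assume "x \<in> K"
    then show "inv x \<in> K" by (auto simp: K_def)
  next
    fix x y assume xy: "x \<in> K" "y \<in> K"
    then have [simp]: "x \<in> carrier G" "y \<in> carrier G" by (auto simp: K_def)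
    have "x \<otimes> y \<otimes> d \<otimes> inv (x \<otimes> y) \<in> D \<and> inv (x \<otimes> y) \<otimes> d \<otimes> (x \<otimes> y) \<in> D" if "d \<in> D" for d
    proof -
      have "x \<otimes> (y \<otimes> d \<otimes> inv y) \<otimes> inv x \<in> D" "inv y \<otimes> (inv x \<otimes> d \<otimes> x) \<otimes> y \<in> D"
        using xy that by (auto simp: K_def)
      then show ?thesis using D_carrier[OF that] by (simp add: m_assoc inv_mult_group)
    qed
    then show "x \<otimes> y \<in> K" by (simp add: K_def)
  qed
  moreover have conj: "inv (a [^] i) \<otimes> d \<otimes> a [^] i \<in> D" "inv (b [^] i) \<otimes> d \<otimes> b [^] i \<in> D"
    if d: "d \<in> D" for d and i :: int
  proof -
    obtain k l where "d = nf 0 0 k l" using d by (auto simp: D_def)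
    then show "inv (a [^] i) \<otimes> d \<otimes> a [^] i \<in> D" "inv (b [^] i) \<otimes> d \<otimes> b [^] i \<in> D"
      using nf_in_D by (simp_all add: m_assoc D_a D_b)
  qed
  moreover have "a \<in> K" "b \<in> K"
    using conj[of _ 1] conj[of _ "-1"] by (auto simp: K_def int_pow_neg)
  moreover have "z \<in> K"
  proof -
    have "z \<otimes> d \<otimes> inv z = d" "inv z \<otimes> d \<otimes> z = d" if "d \<in> D" for d
      using z_central[OF D_carrier[OF that], symmetric] D_carrier[OF that]
      by (simp_all add: m_assoc) (simp add: z_central flip: m_assoc)
    then show ?thesis by (simp add: K_def)
  qed
  ultimately have "K = carrier G" using gen by blast
  then show ?thesis
    using D_subgroup by (auto simp: normal_inv_iff K_def)
qed

section \<open>Coordinates modulo \<open>D\<close>\<close>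

text \<open>\<open>E i j g\<close> says that \<open>g\<close> and \<open>a [^] i \<otimes> b [^] j\<close> agree modulo \<open>D\<close>.\<close>

definition E :: "int \<Rightarrow> int \<Rightarrow> 'a \<Rightarrow> bool" where
  "E i j g \<longleftrightarrow> (\<exists>k l. g = nf i j k l)"

lemma E_carrier: "E i j g \<Longrightarrow> g \<in> carrier G"
  by (auto simp: E_def)

text \<open>Coordinates become an equation in \<open>G Mod D\<close>, where the images of
  \<open>a\<close> and \<open>b\<close> commute; products and powers can be computed there.\<close>

lemma E_iff_quotient:
  assumes g: "g \<in> carrier G"
  shows "E i j g \<longleftrightarrow> D #> g = (D #> a) [^]\<^bsub>G Mod D\<^esub> i \<otimes>\<^bsub>G Mod D\<^esub> (D #> b) [^]\<^bsub>G Mod D\<^esub> j"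
proof -
  interpret D: normal D G by (rule D_normal)
  have q: "(\<lambda>x. D #> x) \<in> hom G (G Mod D)" by (rule D.r_coset_hom_Mod)
  interpret Q: group "G Mod D" by (rule D.factorgroup_is_group)
  have "(D #> a) [^]\<^bsub>G Mod D\<^esub> i \<otimes>\<^bsub>G Mod D\<^esub> (D #> b) [^]\<^bsub>G Mod D\<^esub> j = D #> (a [^] i \<otimes> b [^] j)"
    using hom_int_pow[OF q _ is_group Q.is_group] hom_mult[OF q] by simp
  moreover have "D #> g = D #> h \<longleftrightarrow> (\<exists>d\<in>D. g = h \<otimes> d)" if h: "h \<in> carrier G" for h
  proof -
    \<comment> \<open>The normal form has its \<open>D\<close>-part on the right, so the right coset
      is exchanged for the left one by normality.\<close>
    have "D #> g = D #> h \<longleftrightarrow> g \<in> h <# D"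
    proof
      assume "D #> g = D #> h"
      then show "g \<in> h <# D"
        using rcos_self[OF g D_subgroup] D.coset_eq h by simp
    next
      assume "g \<in> h <# D"
      then show "D #> g = D #> h"
        using repr_independence[of g D h] D.coset_eq h D_subgroup by simp
    qed
    then show ?thesis by (auto simp: l_coset_def)
  qed
  ultimately show ?thesis
    by (auto simp: E_def nf_D[of i j] D_def)
qed

lemma quotient_commute:
  "(D #> a) \<otimes>\<^bsub>G Mod D\<^esub> (D #> b) = (D #> b) \<otimes>\<^bsub>G Mod D\<^esub> (D #> a)"
proof -
  interpret D: normal D G by (rule D_normal)
  have q: "(\<lambda>x. D #> x) \<in> hom G (G Mod D)" by (rule D.r_coset_hom_Mod)
  have "c = nf 0 0 1 0" by (simp add: nf_def)
  then have "c \<in> D" using nf_in_D by metis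
  then have "b \<otimes> a \<otimes> c \<in> (b \<otimes> a) <# D" by (auto simp: l_coset_def)
  then have "b \<otimes> a \<otimes> c \<in> D #> (b \<otimes> a)" using D.coset_eq by simp
  then have "D #> (a \<otimes> b) = D #> (b \<otimes> a)"
    using ab repr_independence D_subgroup by simp
  then show ?thesis using hom_mult[OF q] by simp
qed

lemma
  shows E_mult: "E i j g \<Longrightarrow> E k l h \<Longrightarrow> E (i + k) (j + l) (g \<otimes> h)"
    and E_int_pow: "E i j g \<Longrightarrow> E (r * i) (r * j) (g [^] (r::int))"
proof -
  interpret D: normal D G by (rule D_normal)
  have q: "(\<lambda>x. D #> x) \<in> hom G (G Mod D)" by (rule D.r_coset_hom_Mod)
  interpret Q: group "G Mod D" by (rule D.factorgroup_is_group)
  have cl: "D #> a \<in> carrier (G Mod D)" "D #> b \<in> carrier (G Mod D)"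
    using hom_in_carrier[OF q] by auto
  show "E (i + k) (j + l) (g \<otimes> h)" if g: "E i j g" and h: "E k l h"
    using g h E_carrier[OF g] E_carrier[OF h] hom_mult[OF q, of g h]
      Q.commuting_pows_mult[OF cl quotient_commute, of i j k l]
    by (simp add: E_iff_quotient del: mult_FactGroup)
  show "E (r * i) (r * j) (g [^] r)" if g: "E i j g"
    using g E_carrier[OF g] hom_int_pow[OF q _ is_group Q.is_group, of g r]
      Q.commuting_pows_pow[OF cl quotient_commute, of i j r]
    by (simp add: E_iff_quotient del: mult_FactGroup)
qed

lemma E_one: "E 0 0 \<one>"
  by (auto simp: E_def nf_def intro!: exI[of _ 0])

lemma E_inv: "E i j g \<Longrightarrow> E (- i) (- j) (inv g)"
  using E_int_pow[of i j g "-1"] E_carrier by (simp add: int_pow_neg)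

lemma E_gens: "E 1 0 a" "E 0 1 b" "E 0 0 c" "E 0 0 z"
proof -
  have "a = nf 1 0 0 0" "b = nf 0 1 0 0" "c = nf 0 0 1 0" "z = nf 0 0 0 1"
    by (simp_all add: nf_def)
  then show "E 1 0 a" "E 0 1 b" "E 0 0 c" "E 0 0 z"
    unfolding E_def by blast+
qed

text \<open>The elements that have coordinates form a subgroup containing the generators.\<close>

lemma E_total:
  assumes "g \<in> carrier G"
  obtains i j where "E i j g"
proof -
  have "{g. \<exists>i j. E i j g} = carrier G"
  proof (rule gen)
    show "subgroup {g. \<exists>i j. E i j g} G"
      by (rule subgroupI) (use E_carrier E_one E_mult E_inv in blast)+
  qed (use E_gens in auto)
  then show ?thesis using assms that by auto
qed

section \<open>Reduction and uniqueness of normal forms\<close>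

lemma nf_reduce:
  "\<exists>l'. nf i j k l = nf (i mod int (p ^ \<alpha>)) (j mod int (p ^ \<beta>)) (k mod int p) (l' mod int p)"
proof -
  obtain e f :: int where e: "a [^] int (p ^ \<alpha>) = z [^] e" and f: "b [^] int (p ^ \<beta>) = z [^] f"
    using a_pow b_pow unfolding int_pow_int by blast
  let ?P = "int (p ^ \<alpha>)" and ?Q = "int (p ^ \<beta>)"
  \<comment> \<open>Division with remainder: each full block of \<open>P\<close> factors gives a
    power of the central \<open>z\<close>. These powers collect in the last exponent, hence the
    existential \<open>l'\<close>.\<close>
  have split: "x [^] i = x [^] (i mod P) \<otimes> z [^] (e * (i div P))"
    if "x \<in> carrier G" "x [^] P = z [^] e" for x and i P e :: int
  proof -
    have "x [^] i = x [^] (i mod P + P * (i div P))" by simp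
    also have "\<dots> = x [^] (i mod P) \<otimes> (x [^] P) [^] (i div P)"
      by (metis that(1) int_pow_mult int_pow_pow)
    finally show ?thesis using that by (simp add: int_pow_pow)
  qed
  let ?e = "e * (i div ?P)" and ?f = "f * (j div ?Q)"
  have ck: "c [^] k = c [^] (k mod int p)"
    using int_pow_mod[of c p k] c_p by simp
  have "nf i j k l = a [^] (i mod ?P) \<otimes> z [^] ?e \<otimes> (b [^] (j mod ?Q) \<otimes> z [^] ?f) \<otimes> (c [^] (k mod int p) \<otimes> z [^] l)"
    using split[OF closed(1) e, of i] split[OF closed(2) f, of j] ck by (simp add: nf_def m_assoc)
  also have "\<dots> = a [^] (i mod ?P) \<otimes> b [^] (j mod ?Q) \<otimes> (z [^] (?e + ?f)) \<otimes> (c [^] (k mod int p) \<otimes> z [^] l)"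
    using mult_mult_swap[of "a [^] (i mod ?P)" "z [^] ?e" "b [^] (j mod ?Q)" "z [^] ?f"]
      z_pow_central[of "b [^] (j mod ?Q)" ?e] by (simp add: int_pow_mult)
  also have "\<dots> = nf (i mod ?P) (j mod ?Q) (k mod int p) (?e + ?f + l)"
    using mult_mult_swap[of "a [^] (i mod ?P) \<otimes> b [^] (j mod ?Q)" "z [^] (?e + ?f)" "c [^] (k mod int p)" "z [^] l"]
      z_pow_central[of "c [^] (k mod int p)" "?e + ?f"] by (simp add: nf_def int_pow_mult[of z])
  also have "\<dots> = nf (i mod ?P) (j mod ?Q) (k mod int p) ((?e + ?f + l) mod int p)"
    using int_pow_mod[of z p "?e + ?f + l"] z_p by (simp add: nf_def)
  finally show ?thesis by blast
qed

definition box :: "(int \<times> int \<times> int \<times> int) set" where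
  "box = {0..<int (p ^ \<alpha>)} \<times> {0..<int (p ^ \<beta>)} \<times> {0..<int p} \<times> {0..<int p}"

text \<open>The box has \<open>p ^ (\<alpha> + \<beta> + 2)\<close> elements, so the lower bound on the order of the group makes
  reduced normal forms unique.\<close>

lemma nf_box: "(\<lambda>(i, j, k, l). nf i j k l) ` box = carrier G" (is "?f ` box = _")
proof
  show "?f ` box \<subseteq> carrier G" by auto
  show "carrier G \<subseteq> ?f ` box"
  proof
    fix g assume "g \<in> carrier G"
    then obtain i j where "E i j g" by (rule E_total)
    then obtain k l where "g = nf i j k l" unfolding E_def by blast
    then obtain l' where g: "g = nf (i mod int (p ^ \<alpha>)) (j mod int (p ^ \<beta>)) (k mod int p) (l' mod int p)"
      using nf_reduce by metis
    have "(i mod int (p ^ \<alpha>), j mod int (p ^ \<beta>), k mod int p, l' mod int p) \<in> box"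
      using p_pos by (simp add: box_def)
    from imageI[OF this, of ?f] show "g \<in> ?f ` box"
      unfolding g prod.case .
  qed
qed

lemma card_box: "card box = p ^ (\<alpha> + \<beta> + 2)"
  by (simp add: box_def power_add power2_eq_square del: of_nat_power)

lemma order_eq: "order G = p ^ (\<alpha> + \<beta> + 2)"
  using order_ge card_image_le[of box "\<lambda>(i, j, k, l). nf i j k l"] card_box
  by (simp add: nf_box order_def) (simp add: box_def)

lemma nf_inj: "inj_on (\<lambda>(i, j, k, l). nf i j k l) box"
  using order_eq card_box by (intro eq_card_imp_inj_on) (simp_all add: nf_box order_def, simp add: box_def)

text \<open>The reduced form is compared with the box point \<open>(0, 0, 0, 0)\<close>. Nothing is
  claimed about \<open>l\<close>, which reduction may change: \<open>a [^] (p ^ \<alpha>)\<close>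
  can be a nontrivial power of \<open>z\<close>.\<close>

lemma nf_eq_one:
  assumes "nf i j k l = \<one>"
  shows "int (p ^ \<alpha>) dvd i" "int (p ^ \<beta>) dvd j" "int p dvd k"
proof -
  let ?f = "\<lambda>(i, j, k, l). nf i j k l"
  obtain l' where l': "nf i j k l = nf (i mod int (p ^ \<alpha>)) (j mod int (p ^ \<beta>)) (k mod int p) (l' mod int p)"
    using nf_reduce by blast
  have "(i mod int (p ^ \<alpha>), j mod int (p ^ \<beta>), k mod int p, l' mod int p) = (0, 0, 0, 0)"
  proof (rule inj_onD[OF nf_inj])
    show "?f (i mod int (p ^ \<alpha>), j mod int (p ^ \<beta>), k mod int p, l' mod int p) = ?f (0, 0, 0, 0)"
      using l' assms by (simp add: nf_def)
  qed (use p_pos in \<open>simp_all add: box_def\<close>)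
  then show "int (p ^ \<alpha>) dvd i" "int (p ^ \<beta>) dvd j" "int p dvd k" by auto
qed

lemma nf_one_iff: "nf 0 0 k l = \<one> \<longleftrightarrow> int p dvd k \<and> int p dvd l"
proof
  assume 1: "nf 0 0 k l = \<one>"
  then have k: "int p dvd k" by (rule nf_eq_one)
  then have "c [^] k = \<one>" using int_pow_mod[of c p k] c_p by simp
  then show "int p dvd k \<and> int p dvd l" using k 1 z_pow_eq_one by (simp add: nf_zero)
next
  assume "int p dvd k \<and> int p dvd l"
  then show "nf 0 0 k l = \<one>"
    using int_pow_mod[of c p k] c_p z_pow_eq_one by (simp add: nf_zero)
qed

lemma E_unique:
  assumes "E i j g" "E i' j' g"
  shows "int (p ^ \<alpha>) dvd i - i'" "int (p ^ \<beta>) dvd j - j'"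
proof -
  have "E (i + - i') (j + - j') (g \<otimes> inv g)"
    using E_mult E_inv assms by blast
  then obtain k l where "nf (i - i') (j - j') k l = \<one>"
    using E_carrier[OF assms(1)] by (auto simp: E_def)
  then show "int (p ^ \<alpha>) dvd i - i'" "int (p ^ \<beta>) dvd j - j'"
    using nf_eq_one by blast+
qed

end

section \<open>Orders of non-abelian subgroups\<close>

lemma residue_unique:
  fixes r r' P :: int
  assumes "r \<in> {0..<P}" "r' \<in> {0..<P}" "P dvd r - r'"
  shows "r = r'"
  using assms mod_eq_dvd_iff[of r P r'] by simp

context class3_group
begin

section \<open>Commutators and cosets of \<open>D\<close>\<close>

lemma nf_mult_z: "nf i j k l \<otimes> z [^] m = nf i j k (l + m)"
  by (simp add: nf_def m_assoc int_pow_mult)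

lemma D_inj:
  assumes "nf 0 0 k l = nf 0 0 k' l'" "k \<in> {0..<int p}" "l \<in> {0..<int p}" "k' \<in> {0..<int p}" "l' \<in> {0..<int p}"
  shows "k = k' \<and> l = l'"
proof -
  have "nf 0 0 k l \<otimes> nf 0 0 (- k') (- l') = nf 0 0 k' l' \<otimes> nf 0 0 (- k') (- l')"
    using assms by simp
  then have "nf 0 0 (k - k') (l - l') = nf 0 0 0 0"
    by (simp add: D_mult)
  then have "int p dvd k - k'" "int p dvd l - l'"
    using nf_one_iff[of 0 0] nf_one_iff[of "k - k'" "l - l'"] by simp_all
  then show ?thesis using residue_unique assms by metis
qed

text \<open>Commutators of elements of \<open>D\<close> with \<open>x\<close> see only the first
  coordinate of \<open>x\<close>, so \<open>D\<close> is centralized exactly when that coordinate is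
  divisible by \<open>p\<close>.\<close>

lemma D_E:
  assumes "E i j x"
  shows "nf 0 0 k l \<otimes> x = x \<otimes> nf 0 0 k l \<otimes> z [^] (k * i)"
proof -
  obtain k' l' where x: "x = nf i j k' l'" using assms by (auto simp: E_def)
  have "nf 0 0 k l \<otimes> x = nf 0 0 k l \<otimes> a [^] i \<otimes> b [^] j \<otimes> nf 0 0 k' l'"
    by (simp add: x nf_D[of i j k' l'] m_assoc)
  also have "\<dots> = a [^] i \<otimes> (nf 0 0 k (l + k * i) \<otimes> b [^] j) \<otimes> nf 0 0 k' l'"
    by (simp add: D_a m_assoc)
  also have "\<dots> = nf i j k (l + k * i) \<otimes> nf 0 0 k' l'"
    by (simp add: D_b nf_D[of i j] m_assoc)
  also have "\<dots> = x \<otimes> nf 0 0 k l \<otimes> z [^] (k * i)"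
    by (simp add: x nf_D_mult nf_mult_z algebra_simps)
  finally show ?thesis .
qed

text \<open>The expression is the commutator of \<open>x\<close> and \<open>y\<close>; its
  coordinates cancel, so it lies in \<open>D\<close>.\<close>

lemma E_commutator:
  assumes "x \<in> carrier G" "y \<in> carrier G"
  shows "E 0 0 (inv (y \<otimes> x) \<otimes> (x \<otimes> y))"
proof -
  obtain i j k l where "E i j x" "E k l y" using E_total assms by metis
  then have "E (- (k + i) + (i + k)) (- (l + j) + (j + l)) (inv (y \<otimes> x) \<otimes> (x \<otimes> y))"
    by (intro E_mult E_inv)
  then show ?thesis by simp
qed

lemma commutator_ne_one:
  assumes "x \<in> carrier G" "y \<in> carrier G" "x \<otimes> y \<noteq> y \<otimes> x"
  shows "inv (y \<otimes> x) \<otimes> (x \<otimes> y) \<noteq> \<one>"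
  using assms by (metis inv_equality inv_inv inv_closed m_closed)

lemma commutator_in_subgroup:
  assumes "subgroup H G" "x \<in> H" "y \<in> H"
  shows "inv (y \<otimes> x) \<otimes> (x \<otimes> y) \<in> H"
  using assms by (simp add: subgroup.m_closed subgroup.m_inv_closed)

text \<open>As \<open>i\<close> is prime to \<open>p\<close>, the powers \<open>x [^] r\<close> with
  \<open>0 \<le> r < p ^ \<alpha>\<close> lie in different cosets of \<open>D\<close>.\<close>

lemma pow_D_inj:
  assumes x: "E i j x" and i: "\<not> int p dvd i"
  shows "inj_on (\<lambda>(r, k, l). x [^] (r::int) \<otimes> nf 0 0 k l) ({0..<int (p ^ \<alpha>)} \<times> {0..<int p} \<times> {0..<int p})"
proof (rule inj_onI)
  fix s s'
  assume s: "s \<in> {0..<int (p ^ \<alpha>)} \<times> {0..<int p} \<times> {0..<int p}"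
    and s': "s' \<in> {0..<int (p ^ \<alpha>)} \<times> {0..<int p} \<times> {0..<int p}"
    and ss: "(\<lambda>(r, k, l). x [^] r \<otimes> nf 0 0 k l) s = (\<lambda>(r, k, l). x [^] r \<otimes> nf 0 0 k l) s'"
  obtain r k l r' k' l' where rkl: "s = (r, k, l)" "s' = (r', k', l')"
    by (metis prod.exhaust)
  have r: "r \<in> {0..<int (p ^ \<alpha>)}" "r' \<in> {0..<int (p ^ \<alpha>)}"
    and kl: "k \<in> {0..<int p}" "l \<in> {0..<int p}" "k' \<in> {0..<int p}" "l' \<in> {0..<int p}"
    and eq: "x [^] r \<otimes> nf 0 0 k l = x [^] r' \<otimes> nf 0 0 k' l'"
    using s s' ss unfolding rkl by auto
  have E: "E (r * i + 0) (r * j + 0) (x [^] r \<otimes> nf 0 0 k l)" for r k l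
    by (intro E_mult E_int_pow x) (auto simp: E_def)
  have "int (p ^ \<alpha>) dvd r * i - r' * i"
    using E_unique(1)[OF E[of r k l] E[of r' k' l', folded eq]] by simp
  moreover have "coprime (int (p ^ \<alpha>)) i"
    using i p_int by (simp add: prime_imp_coprime)
  ultimately have "int (p ^ \<alpha>) dvd r - r'"
    by (metis coprime_dvd_mult_left_iff left_diff_distrib)
  then have rr: "r = r'" using residue_unique r by blast
  then have "nf 0 0 k l = nf 0 0 k' l'" using eq E_carrier[OF x] by simp
  then show "s = s'" using D_inj kl rr rkl by blast
qed

lemma card_ge_outside:
  assumes H: "subgroup H G" and nab: "\<exists>x\<in>H. \<exists>y\<in>H. x \<otimes> y \<noteq> y \<otimes> x"
    and x: "x \<in> H" "E i j x" and i: "\<not> int p dvd i"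
  shows "p ^ (\<alpha> + 2) \<le> card H"
proof -
  have finH: "finite H" using fin subgroup.subset[OF H] finite_subset by blast
  have Hc: "h \<in> carrier G" if "h \<in> H" for h using that subgroup.subset[OF H] by blast
  have pw: "h [^] (m::int) \<in> H" if "h \<in> H" for h m
    using subgroup_int_pow_closed[OF H that] .
  have z_mem: "z \<in> H" if "z [^] l \<in> H" "\<not> int p dvd l" for l
    using mem_subgroup_of_coprime_pow[OF H closed(4) z_p _ that(1)] that(2) p_int
    by (metis prime_imp_coprime coprime_commute)
  have inj: "inj_on (\<lambda>(r, k, l). x [^] r \<otimes> nf 0 0 k l) ({0..<int (p ^ \<alpha>)} \<times> {0..<int p} \<times> {0..<int p})"
    by (rule pow_D_inj[OF x(2) i])
  show ?thesis
  \<comment> \<open>The question is whether \<open>H\<close> meets \<open>D\<close> outside the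
    powers of \<open>z\<close>.\<close>
  proof (cases "\<exists>k l. nf 0 0 k l \<in> H \<and> \<not> int p dvd k")
    case True
    then obtain k l where kl: "nf 0 0 k l \<in> H" "\<not> int p dvd k" by blast
    \<comment> \<open>This commutator is a power of \<open>z\<close> with exponent prime to
      \<open>p\<close>, so first \<open>z\<close> and then \<open>c\<close> lies in
      \<open>H\<close>.\<close>
    have "z [^] (k * i) = inv (x \<otimes> nf 0 0 k l) \<otimes> (nf 0 0 k l \<otimes> x)"
      using D_E[OF x(2), of k l] Hc[OF x(1)] by (simp add: m_assoc inv_solve_left)
    then have "z [^] (k * i) \<in> H"
      using commutator_in_subgroup[OF H kl(1) x(1)] by simp
    then have z: "z \<in> H" using z_mem kl(2) i p_int by (meson prime_dvd_multD)
    have "nf 0 0 k l \<otimes> z [^] (- l) \<in> H" using kl(1) z pw subgroup.m_closed[OF H] by blast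
    then have "c [^] k \<in> H" unfolding nf_mult_z by (simp add: nf_zero)
    then have c: "c \<in> H"
      using mem_subgroup_of_coprime_pow[OF H closed(3) c_p, of k] kl(2) p_int
      by (metis prime_imp_coprime coprime_commute)
    have "(\<lambda>(r, k, l). x [^] r \<otimes> nf 0 0 k l) ` ({0..<int (p ^ \<alpha>)} \<times> {0..<int p} \<times> {0..<int p}) \<subseteq> H"
      using pw[OF x(1)] pw[OF z] pw[OF c] subgroup.m_closed[OF H] by (auto simp: nf_zero)
    from card_inj_on_le[OF inj this finH] show ?thesis
      by (simp add: power_add power2_eq_square ac_simps del: of_nat_power)
  next
    \<comment> \<open>Now \<open>H\<close> meets \<open>D\<close> only in powers of
      \<open>z\<close>. The commutator of a non-commuting pair is a nontrivial one, so
      \<open>z\<close> lies in \<open>H\<close>.\<close>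
    case False
    obtain g h where gh: "g \<in> H" "h \<in> H" "g \<otimes> h \<noteq> h \<otimes> g" using nab by blast
    define d where "d = inv (h \<otimes> g) \<otimes> (g \<otimes> h)"
    have d: "d \<in> H" "d \<noteq> \<one>" "E 0 0 d"
      unfolding d_def using gh commutator_in_subgroup[OF H] commutator_ne_one E_commutator Hc by auto
    then obtain k l where kl: "d = nf 0 0 k l" by (auto simp: E_def)
    with d False have k: "int p dvd k" by blast
    then have "d = z [^] l" using kl int_pow_mod[of c p k] c_p by (simp add: nf_zero)
    moreover have "\<not> int p dvd l" using d kl k nf_one_iff by blast
    ultimately have z: "z \<in> H" using d z_mem by blast
    \<comment> \<open>The elements of \<open>K\<close> commute with one another, so \<open>K\<close>
      is smaller than \<open>H\<close>; a power of \<open>p\<close> above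
      \<open>p ^ (\<alpha> + 1)\<close> is at least \<open>p ^ (\<alpha> + 2)\<close>.\<close>
    define K where "K = (\<lambda>(r, k, l). x [^] r \<otimes> nf 0 0 k l) ` ({0..<int (p ^ \<alpha>)} \<times> {0} \<times> {0..<int p})"
    have "inj_on (\<lambda>(r, k, l). x [^] r \<otimes> nf 0 0 k l) ({0..<int (p ^ \<alpha>)} \<times> {0} \<times> {0..<int p})"
      by (rule inj_on_subset[OF inj]) (use p_pos in auto)
    then have "card K = p ^ (\<alpha> + 1)"
      unfolding K_def by (subst card_image) (simp_all del: of_nat_power)
    moreover have "K \<subset> H"
    proof
      show "K \<subseteq> H"
        using pw[OF x(1)] pw[OF z] subgroup.m_closed[OF H] by (auto simp: nf_zero K_def)
      have "s \<otimes> t = t \<otimes> s" if "s \<in> K" "t \<in> K" for s t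
      proof -
        from that obtain r l r' l' :: int where s: "s = x [^] r \<otimes> z [^] l" and t: "t = x [^] r' \<otimes> z [^] l'"
          by (auto simp: K_def nf_zero)
        show ?thesis
          unfolding s t using commuting_pows_mult[of x z r l r' l'] commuting_pows_mult[of x z r' l' r l]
            z_central Hc[OF x(1)] by (simp add: add.commute)
      qed
      then show "K \<noteq> H" using gh by blast
    qed
    ultimately have "p ^ (\<alpha> + 1) < card H" using psubset_card_mono[OF finH] by metis
    moreover obtain s where "card H = p ^ s"
      using card_subgroup_p_power[OF p order_eq fin H] .
    moreover have "p > 1" using p prime_gt_1_nat by blast
    ultimately show ?thesis by (simp add: power_strict_increasing_iff del: power_Suc)
  qed
qed

section \<open>Multiplication in the centralizer \<open>M\<close> of \<open>D\<close>\<close>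

text \<open>The number \<open>t = p (p - 1) / 2\<close> is divisible by \<open>p\<close> exactly when \<open>p\<close> is odd; this is where
  \<open>p = 2\<close> becomes special.\<close>

definition t :: int where "t = int (\<Sum>{..<p})"

text \<open>Collecting the factors \<open>a\<close> on the left moves them past
  \<open>c [^] k\<close> for \<open>k = 0, ..., n - 1\<close>, and each passage leaves
  \<open>k\<close> factors \<open>z\<close>.\<close>

lemma ac_pow: "(a \<otimes> c) [^] (n::nat) = a [^] n \<otimes> c [^] n \<otimes> z [^] int (\<Sum>{..<n})"
proof (induction n)
  case (Suc n)
  have cna: "c [^] n \<otimes> a = a \<otimes> (c [^] n \<otimes> z [^] int n)"
    using c_a_pow[of "int n" 1] by (simp add: int_pow_int m_assoc)
  let ?s = "z [^] int (\<Sum>{..<n})"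
  have "(a \<otimes> c) [^] Suc n = a [^] n \<otimes> c [^] n \<otimes> (?s \<otimes> (a \<otimes> c))"
    by (simp add: Suc m_assoc)
  also have "\<dots> = a [^] n \<otimes> (c [^] n \<otimes> a) \<otimes> (c \<otimes> ?s)"
    by (simp add: m_assoc z_pow_central[of "a \<otimes> c", symmetric])
  also have "\<dots> = a [^] n \<otimes> a \<otimes> (c [^] n \<otimes> z [^] int n \<otimes> (c \<otimes> ?s))"
    unfolding cna by (simp add: m_assoc)
  also have "c [^] n \<otimes> z [^] int n \<otimes> (c \<otimes> ?s) = c [^] n \<otimes> c \<otimes> (z [^] int n \<otimes> ?s)"
    by (rule mult_mult_swap) (simp_all add: z_pow_central)
  also have "z [^] int n \<otimes> ?s = z [^] int (\<Sum>{..<Suc n})"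
    by (simp add: add.commute flip: int_pow_mult)
  finally show ?case by (simp add: m_assoc)
qed (simp add: int_pow_int)

text \<open>Conjugation by \<open>b\<close> takes \<open>a\<close> to \<open>a \<otimes> c\<close>,
  whose \<open>p\<close>-th power loses its \<open>c\<close>-part. So \<open>a [^] p\<close>
  commutes with \<open>b\<close> exactly when \<open>p\<close> divides \<open>t\<close>.\<close>

lemma a_p_b: "a [^] int p \<otimes> b = b \<otimes> a [^] int p \<otimes> z [^] t"
proof -
  have "inv b \<otimes> a \<otimes> b = a \<otimes> c"
    using ab by (simp add: m_assoc)
  then have "inv b \<otimes> a [^] int p \<otimes> b = a [^] int p \<otimes> z [^] t"
    using int_pow_conj[of a b "int p"] ac_pow[of p] c_p by (simp add: int_pow_int t_def)
  then have "b \<otimes> (inv b \<otimes> a [^] int p \<otimes> b) = b \<otimes> (a [^] int p \<otimes> z [^] t)"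
    by simp
  then show ?thesis by (simp add: m_assoc)
qed

lemma b_ap_pow:
  "b [^] (j::int) \<otimes> a [^] (int p * i) = a [^] (int p * i) \<otimes> b [^] j \<otimes> z [^] (- (t * i * j))"
proof -
  have "(a [^] int p) [^] i \<otimes> b [^] j = b [^] j \<otimes> (a [^] int p) [^] i \<otimes> (z [^] t) [^] (i * j)"
    using a_p_b z_pow_central by (intro int_pow_swap_central) auto
  then have "a [^] (int p * i) \<otimes> b [^] j = b [^] j \<otimes> a [^] (int p * i) \<otimes> z [^] (t * i * j)"
    by (simp add: int_pow_pow mult.assoc)
  then have "a [^] (int p * i) \<otimes> b [^] j \<otimes> z [^] (- (t * i * j))
      = b [^] j \<otimes> a [^] (int p * i) \<otimes> (z [^] (t * i * j) \<otimes> z [^] (- (t * i * j)))"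
    by (simp add: m_assoc)
  then show ?thesis by (simp flip: int_pow_mult)
qed

text \<open>The \<open>D\<close>-part commutes with all of \<open>M\<close> because \<open>z\<close>
  has order \<open>p\<close>; the only correction comes from moving \<open>b [^] j\<close> past
  \<open>a [^] (int p * i')\<close>.\<close>

lemma nf_mult_p:
  "nf (int p * i) j k l \<otimes> nf (int p * i') j' k' l'
   = nf (int p * (i + i')) (j + j') (k + k') (l + l' - t * i' * j)"
proof -
  let ?u = "a [^] (int p * i) \<otimes> b [^] j" and ?u' = "a [^] (int p * i') \<otimes> b [^] j'"
  let ?m = "- (t * i' * j)"
  have "E (int p * i') j' ?u'"
    using nf_def[of "int p * i'" j' 0 0] by (auto simp: E_def intro!: exI[of _ 0])
  then have "nf 0 0 k l \<otimes> ?u' = ?u' \<otimes> nf 0 0 k l \<otimes> z [^] (k * (int p * i'))"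
    by (rule D_E)
  moreover have "z [^] (k * (int p * i')) = \<one>" by (simp add: z_pow_eq_one)
  ultimately have "nf 0 0 k l \<otimes> ?u' = ?u' \<otimes> nf 0 0 k l" by simp
  then have "nf (int p * i) j k l \<otimes> nf (int p * i') j' k' l'
      = ?u \<otimes> ?u' \<otimes> nf 0 0 (k + k') (l + l')"
    using mult_mult_swap[of ?u "nf 0 0 k l" ?u' "nf 0 0 k' l'"]
    by (simp add: nf_D[of "int p * i"] nf_D[of "int p * i'"] D_mult)
  also have "?u \<otimes> ?u' = a [^] (int p * i) \<otimes> (b [^] j \<otimes> a [^] (int p * i')) \<otimes> b [^] j'"
    by (simp add: m_assoc)
  also have "\<dots> = a [^] (int p * i) \<otimes> a [^] (int p * i') \<otimes> b [^] j \<otimes> (z [^] ?m \<otimes> b [^] j')"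
    unfolding b_ap_pow by (simp add: m_assoc)
  also have "z [^] ?m \<otimes> b [^] j' = b [^] j' \<otimes> z [^] ?m"
    using z_pow_central[of "b [^] j'" ?m] by simp
  finally have "nf (int p * i) j k l \<otimes> nf (int p * i') j' k' l'
      = a [^] (int p * (i + i')) \<otimes> b [^] (j + j') \<otimes> (z [^] ?m \<otimes> nf 0 0 (k + k') (l + l'))"
    by (simp add: distrib_left int_pow_mult m_assoc)
  also have "z [^] ?m \<otimes> nf 0 0 (k + k') (l + l') = nf 0 0 (k + k') (l + l') \<otimes> z [^] ?m"
    by (rule z_pow_central[symmetric]) simp
  finally show ?thesis
    by (simp add: nf_mult_z nf_D[of "int p * (i + i')"])
qed

text \<open>The exponent is \<open>t\<close> times the determinant of the coordinates, the first
  ones divided by \<open>p\<close>. Hence \<open>M\<close> is abelian for odd \<open>p\<close>, and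
  parity of the determinant decides for \<open>p = 2\<close>.\<close>

lemma commute_p:
  assumes "E (int p * i) j x" "E (int p * i') j' y"
  shows "x \<otimes> y = y \<otimes> x \<otimes> z [^] (t * (i * j' - i' * j))"
proof -
  obtain k l k' l' where "x = nf (int p * i) j k l" "y = nf (int p * i') j' k' l'"
    using assms by (auto simp: E_def)
  then show ?thesis
    unfolding nf_mult_p nf_mult_z by (simp add: nf_mult_p nf_mult_z add.commute) (simp add: algebra_simps)
qed

lemma t_odd: "p \<noteq> 2 \<Longrightarrow> int p dvd t"
proof -
  assume "p \<noteq> 2"
  then have odd: "odd p" using p prime_odd_nat prime_ge_2_nat by (metis le_neq_implies_less)
  have "2 * (\<Sum>{..<p}) = p * (p - 1)"
    using gauss_sum_nat[of "p - 1"] p_pos lessThan_Suc_atMost[of "p - 1"]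
    by (simp add: atLeast0AtMost algebra_simps)
  then have "p dvd 2 * (\<Sum>{..<p})" by simp
  moreover have "coprime p 2" using odd by simp
  ultimately have "p dvd \<Sum>{..<p}" by (simp add: coprime_dvd_mult_right_iff)
  then show ?thesis unfolding t_def by (simp only: int_dvd_int_iff)
qed

lemma t_two: "p = 2 \<Longrightarrow> t = 1"
  unfolding t_def by (simp add: numeral_2_eq_2)

lemma card_ge_inside:
  assumes p2: "p = 2" and \<alpha>: "\<alpha> \<ge> 1" 
    and H: "subgroup H G" and nab: "\<exists>x\<in>H. \<exists>y\<in>H. x \<otimes> y \<noteq> y \<otimes> x"
    and M: "\<And>x. x \<in> H \<Longrightarrow> \<exists>i j. E (int p * i) j x"
  shows "2 ^ (\<alpha> + \<beta>) \<le> card H"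
proof -
  have finH: "finite H" using fin subgroup.subset[OF H] finite_subset by blast
  have Hc: "h \<in> carrier G" if "h \<in> H" for h using that subgroup.subset[OF H] by blast
  obtain x y where xy: "x \<in> H" "y \<in> H" "x \<otimes> y \<noteq> y \<otimes> x" using nab by blast
  obtain i j k l where x: "E (2 * i) j x" and y: "E (2 * k) l y"
    using M xy p2 by (metis of_nat_numeral)
  define \<delta> where "\<delta> = i * l - k * j"
  have "x \<otimes> y = y \<otimes> x \<otimes> z [^] \<delta>"
    using commute_p[of i j x k l y] x y p2 t_two by (simp add: \<delta>_def)
  then have "z [^] \<delta> \<noteq> \<one>" using xy Hc by auto
  \<comment> \<open>An odd determinant is invertible modulo powers of \<open>2\<close>, so
    \<open>x\<close> and \<open>y\<close> generate \<open>M\<close> modulo \<open>D\<close>.\<close>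
  then have "odd \<delta>" using z_pow_eq_one p2 by simp
  then have "coprime \<delta> (2 ^ (\<alpha> + \<beta>))" by simp
  then obtain \<epsilon> where "[\<delta> * \<epsilon> = 1] (mod 2 ^ (\<alpha> + \<beta>))"
    using cong_solve_coprime_int by blast
  then have \<epsilon>: "2 ^ (\<alpha> + \<beta>) dvd \<delta> * \<epsilon> - 1" by (simp add: cong_iff_dvd_diff)
  then have \<epsilon>\<alpha>: "2 ^ \<alpha> dvd \<delta> * \<epsilon> - 1" and \<epsilon>\<beta>: "2 ^ \<beta> dvd \<delta> * \<epsilon> - 1"
    using dvd_trans[OF le_imp_power_dvd[of _ "\<alpha> + \<beta>" "2::int"]] by simp_all
  \<comment> \<open>\<open>Q s r g\<close> prescribes the coordinates \<open>2 * s\<close> and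
    \<open>r\<close> of \<open>g\<close> modulo \<open>2 ^ \<alpha>\<close> and
    \<open>2 ^ \<beta>\<close>.\<close>
  define Q where "Q s r g \<longleftrightarrow> (\<exists>u v. E u v g \<and> 2 ^ \<alpha> dvd u - 2 * s \<and> 2 ^ \<beta> dvd v - r)" for s r g
  have "\<exists>g. g \<in> H \<and> Q s r g" for s r
  proof -
    \<comment> \<open>Cramer's rule for the system \<open>m i + n k = s\<close>, \<open>m j + n l = r\<close> modulo a power of \<open>2\<close>\<close>
    define m where "m = \<epsilon> * (s * l - r * k)"
    define n where "n = \<epsilon> * (i * r - j * s)"
    have "E (m * (2 * i) + n * (2 * k)) (m * j + n * l) (x [^] m \<otimes> y [^] n)"
      by (intro E_mult E_int_pow x y)
    moreover have "m * (2 * i) + n * (2 * k) - 2 * s = (\<delta> * \<epsilon> - 1) * (2 * s)"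
      by (simp add: m_def n_def \<delta>_def algebra_simps)
    then have "2 ^ \<alpha> dvd m * (2 * i) + n * (2 * k) - 2 * s"
      using \<epsilon>\<alpha> by (simp only: dvd_mult2)
    moreover have "m * j + n * l - r = (\<delta> * \<epsilon> - 1) * r"
      by (simp add: m_def n_def \<delta>_def algebra_simps)
    then have "2 ^ \<beta> dvd m * j + n * l - r"
      using \<epsilon>\<beta> by (simp only: dvd_mult2)
    ultimately have "Q s r (x [^] m \<otimes> y [^] n)"
      unfolding Q_def by blast
    moreover have "x [^] m \<otimes> y [^] n \<in> H"
      using xy subgroup_int_pow_closed[OF H] subgroup.m_closed[OF H] by blast
    ultimately show ?thesis by blast
  qed
  then obtain h where hH: "\<And>s r. h s r \<in> H" and hQ: "\<And>s r. Q s r (h s r)"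
    by metis
  define d where "d = inv (y \<otimes> x) \<otimes> (x \<otimes> y)"
  have d: "d \<in> H" "d \<noteq> \<one>" "E 0 0 d"
    unfolding d_def using xy commutator_in_subgroup[OF H] commutator_ne_one E_commutator Hc by auto
  \<comment> \<open>The pairs \<open>(s, r)\<close> index the cosets of \<open>D\<close> in
    \<open>M\<close>; the truth value decides whether the representative is multiplied by
    \<open>d\<close>, a nontrivial element of \<open>D\<close>.\<close>
  define B where "B = {0..<2 ^ (\<alpha> - 1) :: int} \<times> {0..<2 ^ \<beta> :: int} \<times> (UNIV :: bool set)"
  define f where "f = (\<lambda>(s, r, e). h s r \<otimes> (if e then d else \<one>))"
  have "inj_on f B"
  proof (rule inj_onI)
    fix w w' assume w: "w \<in> B" "w' \<in> B" and ww: "f w = f w'"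
    obtain s r e s' r' e' where wdef: "w = (s, r, e)" "w' = (s', r', e')"
      by (metis prod.exhaust)
    have eq: "h s r \<otimes> (if e then d else \<one>) = h s' r' \<otimes> (if e' then d else \<one>)"
      using ww by (simp add: f_def wdef)
    obtain u v where E1: "E u v (h s r)" and u: "2 ^ \<alpha> dvd u - 2 * s" and v: "2 ^ \<beta> dvd v - r"
      using hQ[of s r] unfolding Q_def by blast
    obtain u' v' where E2: "E u' v' (h s' r')" and u': "2 ^ \<alpha> dvd u' - 2 * s'" and v': "2 ^ \<beta> dvd v' - r'"
      using hQ[of s' r'] unfolding Q_def by blast
    have "E (u + 0) (v + 0) (h s r \<otimes> (if e then d else \<one>))"
      by (rule E_mult[OF E1]) (use d E_one in auto)
    moreover have "E (u' + 0) (v' + 0) (h s' r' \<otimes> (if e' then d else \<one>))"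
      by (rule E_mult[OF E2]) (use d E_one in auto)
    ultimately have "int (p ^ \<alpha>) dvd u + 0 - (u' + 0)" "int (p ^ \<beta>) dvd v + 0 - (v' + 0)"
      unfolding eq by (rule E_unique)+
    then have uu: "2 ^ \<alpha> dvd u - u'" and vv: "2 ^ \<beta> dvd v - v'"
      using p2 by simp_all
    have 1: "2 ^ \<alpha> dvd (u - u') - (u - 2 * s) + (u' - 2 * s')"
      by (intro dvd_add dvd_diff uu u u')
    have "2 ^ \<beta> dvd (v - v') - (v - r) + (v' - r')"
      by (intro dvd_add dvd_diff vv v v')
    then have "2 ^ \<beta> dvd r - r'" by simp
    moreover have "r \<in> {0..<2 ^ \<beta>}" "r' \<in> {0..<2 ^ \<beta>}"
      using w by (simp_all add: B_def wdef)
    ultimately have r: "r = r'" using residue_unique by blast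
    have "(2::int) ^ \<alpha> = 2 * 2 ^ (\<alpha> - 1)" using \<alpha> by (cases \<alpha>) simp_all
    moreover have "(u - u') - (u - 2 * s) + (u' - 2 * s') = 2 * (s - s')" by simp
    ultimately have "2 ^ (\<alpha> - 1) dvd s - s'"
      using 1 by (metis dvd_mult_cancel_left zero_neq_numeral)
    moreover have "s \<in> {0..<2 ^ (\<alpha> - 1)}" "s' \<in> {0..<2 ^ (\<alpha> - 1)}"
      using w by (simp_all add: B_def wdef)
    ultimately have s: "s = s'" using residue_unique by blast
    have "e = e'" using eq r s d(2) Hc[OF hH] Hc[OF d(1)] by (auto split: if_splits)
    then show "w = w'" using r s wdef by simp
  qed
  moreover have "f ` B \<subseteq> H"
    using hH d(1) subgroup.m_closed[OF H] subgroup.one_closed[OF H] by (auto simp: f_def)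
  ultimately have "card B \<le> card H" using card_inj_on_le finH by blast
  moreover have "card B = 2 ^ (\<alpha> - 1) * (2 ^ \<beta> * 2)"
    by (simp add: B_def card_UNIV_bool nat_power_eq)
  moreover have "(2::nat) ^ (\<alpha> - 1) * (2 ^ \<beta> * 2) = 2 ^ (\<alpha> + \<beta>)"
    using \<alpha> by (cases \<alpha>) (simp_all add: power_add)
  ultimately show ?thesis by simp
qed

text \<open>For odd \<open>p\<close> a non-abelian \<open>H\<close> must leave the abelian
  \<open>M\<close>. The exponent \<open>s\<close> is free because the minimum is
  \<open>\<alpha> + 2\<close> in general but \<open>\<alpha> + 1\<close> for \<open>p = 2\<close>,
  \<open>\<beta> = 1\<close>.\<close>

lemma card_ge:
  assumes "p = 2 \<Longrightarrow> \<alpha> \<ge> 1 \<and> s \<le> \<alpha> + \<beta>" and "s \<le> \<alpha> + 2"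
    and H: "subgroup H G" and nab: "\<exists>x\<in>H. \<exists>y\<in>H. x \<otimes> y \<noteq> y \<otimes> x"
  shows "p ^ s \<le> card H"
proof (cases "\<exists>x\<in>H. \<exists>i j. E i j x \<and> \<not> int p dvd i")
  case True
  then have "p ^ (\<alpha> + 2) \<le> card H" using card_ge_outside[OF H nab] by blast
  then show ?thesis
    using assms(2) p_pos power_increasing[of s "\<alpha> + 2" p] by linarith
next
  case False
  have M: "\<exists>i j. E (int p * i) j x" if "x \<in> H" for x
    using False that E_total subgroup.mem_carrier[OF H that] by (metis dvdE)
  show ?thesis
  proof (cases "p = 2")
    case True
    have "p ^ s \<le> p ^ (\<alpha> + \<beta>)"
      using assms(1)[OF True] p_pos by (intro power_increasing) auto
    also have "\<dots> \<le> card H"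
      using card_ge_inside[OF True _ H nab M] assms(1) True by metis
    finally show ?thesis .
  next
    case p2: False
    have "x \<otimes> y = y \<otimes> x" if xy: "x \<in> H" "y \<in> H" for x y
    proof -
      obtain i j i' j' where "E (int p * i) j x" "E (int p * i') j' y" using M xy by metis
      from commute_p[OF this] show ?thesis
        using t_odd[OF p2] z_pow_eq_one subgroup.mem_carrier[OF H] xy by simp
    qed
    with nab show ?thesis by blast
  qed
qed

text \<open>\<open>S\<close> is \<open>\<langle>a, c\<rangle>\<close>, which contains
  \<open>z\<close> as the commutator of \<open>c\<close> and \<open>a\<close>; its reduced forms
  have second exponent \<open>0\<close>.\<close>

lemma nonabelian_subgroup_a_c:
  obtains S where "subgroup S G" "card S \<le> p ^ (\<alpha> + 2)" "\<exists>x\<in>S. \<exists>y\<in>S. x \<otimes> y \<noteq> y \<otimes> x"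
proof
  define S where "S = {g. \<exists>i. E i 0 g}"
  show "subgroup S G"
  proof (rule subgroupI)
    show "S \<subseteq> carrier G" using E_carrier by (auto simp: S_def)
    show "S \<noteq> {}" using E_one by (auto simp: S_def)
    show "inv x \<in> S" if "x \<in> S" for x
      using that E_inv[of _ 0] by (auto simp: S_def)
    show "x \<otimes> y \<in> S" if xy: "x \<in> S" "y \<in> S" for x y
    proof -
      obtain i k where "E i 0 x" "E k 0 y" using xy by (auto simp: S_def)
      from E_mult[OF this] show ?thesis by (auto simp: S_def)
    qed
  qed
  let ?B = "{0..<int (p ^ \<alpha>)} \<times> {0..<int p} \<times> {0..<int p}" and ?f = "\<lambda>(i, k, l). nf i 0 k l"
  have "S \<subseteq> ?f ` ?B"
  proof
    fix g assume "g \<in> S"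
    then obtain i k l where "g = nf i 0 k l" by (auto simp: S_def E_def)
    then obtain l' where g: "g = nf (i mod int (p ^ \<alpha>)) 0 (k mod int p) (l' mod int p)"
      using nf_reduce[of i 0 k l] by auto
    have "(i mod int (p ^ \<alpha>), k mod int p, l' mod int p) \<in> ?B"
      using p_pos by simp
    from imageI[OF this, of ?f] show "g \<in> ?f ` ?B" unfolding g prod.case .
  qed
  then have "card S \<le> card ?B" by (rule surj_card_le[rotated]) simp
  then show "card S \<le> p ^ (\<alpha> + 2)"
    by (simp add: power_add power2_eq_square ac_simps del: of_nat_power)
  have "c \<otimes> a \<noteq> a \<otimes> c" using ca z_ne by simp
  moreover have "a \<in> S" "c \<in> S" using E_gens by (auto simp: S_def)
  ultimately show "\<exists>x\<in>S. \<exists>y\<in>S. x \<otimes> y \<noteq> y \<otimes> x" by blast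
qed

text \<open>The normal forms in \<open>M\<close> without \<open>c\<close> are closed under products,
  since commutators in \<open>M\<close> are powers of \<open>z\<close>. They are non-abelian because
  \<open>t = 1\<close>.\<close>

lemma nonabelian_subgroup_a2_b:
  assumes p2: "p = 2" and \<alpha>: "\<alpha> \<ge> 1" and \<beta>: "\<beta> = 1"
  obtains S where "subgroup S G" "card S \<le> 2 ^ (\<alpha> + 1)" "\<exists>x\<in>S. \<exists>y\<in>S. x \<otimes> y \<noteq> y \<otimes> x"
proof
  define S where "S = {nf (int p * i) j 0 l | i j l. True}"
  have nfS: "nf (int p * i) j 0 l \<in> S" for i j l by (auto simp: S_def)
  show "subgroup S G"
  proof (rule subgroupI)
    show "S \<subseteq> carrier G" by (auto simp: S_def)
    show "S \<noteq> {}" using nfS by blast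
    show "inv x \<in> S" if x: "x \<in> S" for x
    proof -
      obtain i j l where x: "x = nf (int p * i) j 0 l" using x by (auto simp: S_def)
      have "nf (int p * i) j 0 l \<otimes> nf (int p * (- i)) (- j) 0 (- l - t * i * j) = nf 0 0 0 0"
        unfolding nf_mult_p by simp
      then have "inv x = nf (int p * (- i)) (- j) 0 (- l - t * i * j)"
        using x nf_one_iff[of 0 0] by (metis dvd_0_right inv_equality inv_inv nf_closed)
      then show ?thesis by (simp only: nfS)
    qed
    show "x \<otimes> y \<in> S" if xy: "x \<in> S" "y \<in> S" for x y
    proof -
      obtain i j l i' j' l' where "x = nf (int p * i) j 0 l" "y = nf (int p * i') j' 0 l'"
        using xy unfolding S_def by blast
      then have "x \<otimes> y = nf (int p * (i + i')) (j + j') 0 (l + l' - t * i' * j)"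
        using nf_mult_p[of i j 0 l i' j' 0 l'] by (simp only: add_0)
      then show ?thesis by (simp only: nfS)
    qed
  qed
  let ?B = "{0..<2 ^ (\<alpha> - 1) :: int} \<times> {0..<2::int} \<times> {0..<2::int}" and ?f = "\<lambda>(i, j, l). nf (2 * i) j 0 l"
  have "S \<subseteq> ?f ` ?B"
  proof
    fix g assume "g \<in> S"
    then obtain i j l where "g = nf (2 * i) j 0 l" using p2 unfolding S_def by auto
    moreover obtain l' where "nf (2 * i) j 0 l
        = nf (2 * i mod int (p ^ \<alpha>)) (j mod int (p ^ \<beta>)) (0 mod int p) (l' mod int p)"
      using nf_reduce[of "2 * i" j 0 l] by (elim exE)
    ultimately have g: "g = nf (2 * i mod 2 ^ \<alpha>) (j mod 2) 0 (l' mod 2)"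
      by (simp add: p2 \<beta>)
    have "(2::int) ^ \<alpha> = 2 * 2 ^ (\<alpha> - 1)" using \<alpha> by (cases \<alpha>) simp_all
    then have "2 * i mod 2 ^ \<alpha> = 2 * (i mod 2 ^ (\<alpha> - 1))" by (simp only: mod_mult_mult1)
    with g have g: "g = nf (2 * (i mod 2 ^ (\<alpha> - 1))) (j mod 2) 0 (l' mod 2)" by (simp only:)
    have "(i mod 2 ^ (\<alpha> - 1), j mod 2, l' mod 2) \<in> ?B" by simp
    from imageI[OF this, of ?f] show "g \<in> ?f ` ?B" unfolding g prod.case .
  qed
  then have "card S \<le> card ?B" by (rule surj_card_le[rotated]) simp
  also have "card ?B = 2 ^ (\<alpha> + 1)"
    using \<alpha> by (cases \<alpha>) (simp_all add: nat_power_eq)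
  finally show "card S \<le> 2 ^ (\<alpha> + 1)" .
  have "a [^] int p \<otimes> b \<noteq> b \<otimes> a [^] int p"
    using a_p_b t_two[OF p2] z_ne by simp
  moreover have "a [^] int p \<in> S" "b \<in> S"
    using nfS[of 1 0 0] nfS[of 0 1 0] by (simp_all add: nf_def)
  ultimately show "\<exists>x\<in>S. \<exists>y\<in>S. x \<otimes> y \<noteq> y \<otimes> x" by blast
qed

section \<open>Indices of the smallest non-abelian subgroups\<close>

lemma class_A_generic:
  assumes "p = 2 \<Longrightarrow> \<alpha> \<ge> 1 \<and> \<beta> \<ge> 2"
  shows "class_A p (\<beta> + 1) G"
proof -
  obtain S where S: "subgroup S G" "card S \<le> p ^ (\<alpha> + 2)" "\<exists>x\<in>S. \<exists>y\<in>S. x \<otimes> y \<noteq> y \<otimes> x"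
    by (rule nonabelian_subgroup_a_c)
  \<comment> \<open>The least order \<open>p ^ (\<alpha> + 2)\<close> leaves the index
    \<open>p ^ \<beta>\<close>; if \<open>p = 2\<close>, then \<open>\<beta> \<ge> 2\<close> keeps
    it within the bound for subgroups of \<open>M\<close>.\<close>
  have "order G = p ^ (\<alpha> + 2 + \<beta>)"
    using order_eq by (simp only: ac_simps)
  from class_A_of_minimal_order[OF p fin this card_ge S] show ?thesis
    using assms by simp
qed

lemma class_A_two:
  assumes "p = 2" "\<alpha> \<ge> 1" "\<beta> = 1"
  shows "class_A p 3 G"
proof -
  obtain S where S: "subgroup S G" "card S \<le> p ^ (\<alpha> + 1)" "\<exists>x\<in>S. \<exists>y\<in>S. x \<otimes> y \<noteq> y \<otimes> x"
    using nonabelian_subgroup_a2_b[OF assms] assms(1) by metis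
  \<comment> \<open>The least order drops to \<open>2 ^ (\<alpha> + 1)\<close>, so the index is
    \<open>4\<close> rather than \<open>2 ^ \<beta>\<close>.\<close>
  have "order G = p ^ (\<alpha> + 1 + 2)"
    using order_eq assms(3) by (simp only: ac_simps)
  from class_A_of_minimal_order[OF p fin this card_ge S] show ?thesis
    using assms by simp
qed

end

section \<open>The order of the group \<open>M\<^sub>p(n, m, 1)\<close>\<close>

text \<open>The lower bound for the order of \<open>M\<^sub>p(n, m, 1)\<close> comes from evaluating words in the integral
  Heisenberg group and reducing the coordinates modulo \<open>p ^ n\<close>, \<open>p ^ m\<close> and \<open>p\<close>.\<close>

type_synonym heis = "int \<times> int \<times> int"

text \<open>The triple stands for the unitriangular 3 by 3 matrix with \<open>i\<close> and
  \<open>j\<close> next to the diagonal and \<open>k\<close> in the corner.\<close>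

definition heis_mult :: "heis \<Rightarrow> heis \<Rightarrow> heis" where
  "heis_mult = (\<lambda>(i, j, k) (i', j', k'). (i + i', j + j', k + k' + i * j'))"

definition heis_letter :: "Mp_gen \<times> bool \<Rightarrow> heis" where
  "heis_letter = (\<lambda>(x, e). let s = (if e then 1 else - 1) in
     case x of Gen_a \<Rightarrow> (s, 0, 0) | Gen_b \<Rightarrow> (0, s, 0) | Gen_c \<Rightarrow> (0, 0, s))"

definition heis :: "Mp_gen gword \<Rightarrow> heis" where
  "heis u = foldr (\<lambda>x. heis_mult (heis_letter x)) u (0, 0, 0)"

lemma heis_Nil [simp]: "heis [] = (0, 0, 0)"
  and heis_Cons [simp]: "heis (x # u) = heis_mult (heis_letter x) (heis u)"
  by (simp_all add: heis_def)

lemma heis_mult_assoc: "heis_mult (heis_mult u v) w = heis_mult u (heis_mult v w)"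
  by (auto simp: heis_mult_def algebra_simps split: prod.splits)

lemma heis_mult_zero [simp]: "heis_mult (0, 0, 0) u = u"
  by (simp add: heis_mult_def split: prod.splits)

lemma heis_append: "heis (u @ v) = heis_mult (heis u) (heis v)"
  by (induction u) (simp_all add: heis_mult_assoc)

lemma heis_pow:
  "heis (gword_pow [(Gen_a, True)] k) = (int k, 0, 0)"
  "heis (gword_pow [(Gen_b, True)] k) = (0, int k, 0)"
  "heis (gword_pow [(Gen_c, True)] k) = (0, 0, int k)"
  by (induction k) (simp_all add: gword_pow_def heis_letter_def heis_mult_def)

definition heis_cong :: "nat \<Rightarrow> nat \<Rightarrow> nat \<Rightarrow> heis \<Rightarrow> heis \<Rightarrow> bool" where
  "heis_cong p n m = (\<lambda>(i, j, k) (i', j', k').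
     [i = i'] (mod int (p ^ n)) \<and> [j = j'] (mod int (p ^ m)) \<and> [k = k'] (mod int p))"

text \<open>The corner of a product contains \<open>i * j'\<close>, which is determined modulo
  \<open>p\<close> because \<open>p\<close> divides \<open>p ^ n\<close> and \<open>p ^ m\<close>;
  this uses that \<open>n\<close> and \<open>m\<close> are positive.\<close>

lemma heis_cong_mult:
  assumes "n \<ge> 1" "m \<ge> 1" "heis_cong p n m u u'" "heis_cong p n m v v'"
  shows "heis_cong p n m (heis_mult u v) (heis_mult u' v')"
proof -
  have *: "[x = y] (mod int p)" if "[x = y] (mod int (p ^ l))" "l \<ge> 1" for x y l
  proof -
    have "int p dvd int (p ^ l)" using that(2) by (simp add: dvd_power)
    then show ?thesis using that(1) cong_dvd_modulus by blast
  qed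
  show ?thesis
    using assms *[of _ _ n] *[of _ _ m]
    by (auto simp: heis_cong_def heis_mult_def simp del: of_nat_power split: prod.splits
        intro!: cong_add cong_mult)
qed

lemma heis_cong_relation:
  assumes "(l, r) \<in> Mp_relations p n m"
  shows "heis_cong p n m (heis l) (heis r)"
proof -
  have 0: "[int P = 0] (mod int P)" for P
    by (simp add: cong_0_iff)
  show ?thesis
    using assms 0[of p] 0[of "p ^ n"] 0[of "p ^ m"]
    by (auto simp: Mp_relations_def Let_def heis_pow heis_cong_def gword_comm_def gword_inv_def
        heis_letter_def heis_mult_def simp del: of_nat_power)
qed

text \<open>Every rule generating \<open>pres_eq\<close> respects the evaluation, so words with
  incongruent values represent different elements.\<close>

lemma heis_cong_pres_eq:
  assumes "pres_eq (Mp_relations p n m) u v" "n \<ge> 1" "m \<ge> 1"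
  shows "heis_cong p n m (heis u) (heis v)"
  using assms(1)
proof induction
  case (refl u)
  then show ?case by (simp add: heis_cong_def split: prod.splits)
next
  case (sym u v)
  then show ?case by (auto simp: heis_cong_def cong_sym split: prod.splits)
next
  case (trans u v w)
  then show ?case by (auto simp: heis_cong_def split: prod.splits intro: cong_trans)
next
  case (cancel u x e v)
  have "heis_mult (heis_letter (x, e)) (heis_mult (heis_letter (x, \<not> e)) w) = w" for w
    by (cases x) (auto simp: heis_letter_def heis_mult_def split: prod.splits)
  then have "heis (u @ [(x, e), (x, \<not> e)] @ v) = heis (u @ v)"
    by (simp add: heis_append)
  then show ?case by (simp add: heis_cong_def split: prod.splits)
next
  case (rel l r u v)
  have r: "heis_cong p n m w w" for w by (simp add: heis_cong_def split: prod.splits)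
  show ?case
    unfolding heis_append
    using heis_cong_mult heis_cong_relation[OF rel] r assms(2,3) by blast
qed

text \<open>The words \<open>a ^ i b ^ j c ^ k\<close> evaluate to \<open>(i, j, k + i * j)\<close>,
  from which \<open>i\<close> and \<open>j\<close> are recovered first and then
  \<open>k\<close>.\<close>

lemma card_Mp_group_ge:
  assumes fin: "finite (carrier (Mp_group p n m))" and "n \<ge> 1" "m \<ge> 1"
  shows "p ^ (n + m + 1) \<le> card (carrier (Mp_group p n m))"
proof -
  let ?R = "Mp_relations p n m"
  define W where "W = (\<lambda>(i, j, k). gword_pow [(Gen_a, True)] i @ gword_pow [(Gen_b, True)] j @ gword_pow [(Gen_c, True)] k)"
  let ?B = "{..<p ^ n} \<times> {..<p ^ m} \<times> {..<p}"
  define F where "F s = {(u, v). pres_eq ?R u v} `` {W s}" for s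
  have W: "heis (W (i, j, k)) = (int i, int j, int k + int i * int j)" for i j k
    by (simp add: W_def heis_append heis_pow heis_mult_def)
  have "inj_on F ?B"
  proof (rule inj_onI)
    fix s s' assume s: "s \<in> ?B" "s' \<in> ?B" and eq: "F s = F s'"
    obtain i j k i' j' k' where ijk: "s = (i, j, k)" "s' = (i', j', k')" by (metis prod.exhaust)
    have "W s' \<in> F s" unfolding eq by (simp add: F_def pres_eq.refl)
    then have "pres_eq ?R (W s) (W s')" by (simp add: F_def)
    then have "heis_cong p n m (heis (W s)) (heis (W s'))"
      using heis_cong_pres_eq assms by blast
    then have c: "[int i = int i'] (mod int (p ^ n))" "[int j = int j'] (mod int (p ^ m))"
      "[int k + int i * int j = int k' + int i' * int j'] (mod int p)"
      by (simp_all add: ijk W heis_cong_def)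
    have i: "i = i'" using c(1) s unfolding cong_int_iff by (simp add: ijk cong_def)
    have j: "j = j'" using c(2) s unfolding cong_int_iff by (simp add: ijk cong_def)
    have "[int k = int k'] (mod int p)" using c(3) i j cong_add_rcancel by blast
    then have k: "k = k'" using s unfolding cong_int_iff by (simp add: ijk cong_def)
    show "s = s'" using i j k ijk by simp
  qed
  moreover have "F s \<in> carrier (Mp_group p n m)" for s
    unfolding F_def Mp_group_def presented_group_def partial_object.select_convs
    by (rule quotientI) simp
  then have "F ` ?B \<subseteq> carrier (Mp_group p n m)" by blast
  ultimately have "card ?B \<le> card (carrier (Mp_group p n m))"
    using card_inj_on_le fin by blast
  then show ?thesis by (simp add: power_add ac_simps)
qed

section \<open>The centre, the derived subgroup and the Frattini subgroup\<close>

lemma (in group) commutator_eq: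
  "x \<in> carrier G \<Longrightarrow> y \<in> carrier G \<Longrightarrow> x \<otimes> y = y \<otimes> x \<otimes> commutator G x y"
  by (simp add: commutator_def m_assoc)

lemma (in group) commutator_closed [simp]:
  "x \<in> carrier G \<Longrightarrow> y \<in> carrier G \<Longrightarrow> commutator G x y \<in> carrier G"
  by (simp add: commutator_def)

lemma (in group_hom) hom_commutator:
  "x \<in> carrier G \<Longrightarrow> y \<in> carrier G \<Longrightarrow> h (commutator G x y) = commutator H (h x) (h y)"
  by (simp add: commutator_def)

lemma (in group) commutator_in_derived:
  assumes "x \<in> carrier G" "y \<in> carrier G"
  shows "commutator G x y \<in> derived G (carrier G)"
proof -
  \<comment> \<open>The library's commutator of \<open>inv x\<close> and \<open>inv y\<close> is the
    one wanted here.\<close>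
  have "inv x \<otimes> inv y \<otimes> x \<otimes> y = inv x \<otimes> inv y \<otimes> inv (inv x) \<otimes> inv (inv y)"
    using assms by simp
  then have "inv x \<otimes> inv y \<otimes> x \<otimes> y \<in> derived_set G (carrier G)"
    using assms by (intro UN_I[of "inv x"] UN_I[of "inv y"]) simp_all
  then show ?thesis
    unfolding commutator_def derived_def by (rule generate.incl)
qed

text \<open>A conjugate of a commutator is the commutator of the conjugates, and the derived
  subgroup is normal; so the generating set is closed under conjugation.\<close>

lemma (in group) G3_normal: "G3 G \<lhd> G"
  unfolding G3_def commutator_subgroup_def
proof (rule normal_generateI)
  interpret N: normal "derived G (carrier G)" G by (rule derived_self_is_normal)
  show "{commutator G x y |x y. x \<in> derived G (carrier G) \<and> y \<in> carrier G} \<subseteq> carrier G"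
    by auto
  fix h g
  assume "h \<in> {commutator G x y |x y. x \<in> derived G (carrier G) \<and> y \<in> carrier G}" and g: "g \<in> carrier G"
  then obtain x y where h: "h = commutator G x y" and x: "x \<in> derived G (carrier G)" and y: "y \<in> carrier G"
    by blast
  have eq: "g \<otimes> h \<otimes> inv g = commutator G (g \<otimes> x \<otimes> inv g) (g \<otimes> y \<otimes> inv g)"
    using g x y by (simp add: h commutator_def inv_mult_group m_assoc)
  then show "g \<otimes> h \<otimes> inv g \<in> {commutator G x y |x y. x \<in> derived G (carrier G) \<and> y \<in> carrier G}"
    by (intro CollectI exI conjI) (rule eq, rule N.inv_op_closed2[OF g x], use g y in simp)
qed

section \<open>Centrality of normal subgroups of order \<open>p\<close>\<close>

lemma fermat_power:
  fixes p r :: nat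
  assumes "Factorial_Ring.prime p"
  shows "[r ^ (p ^ k) = r] (mod p)"
proof (induction k)
  case (Suc k)
  have fermat: "[s ^ p = s] (mod p)" for s :: nat
  proof (cases "p dvd s")
    case True
    moreover from this have "p dvd s ^ p"
      using dvd_trans[OF True dvd_power] prime_gt_0_nat[OF assms] by blast
    ultimately show ?thesis by (simp add: cong_def dvd_imp_mod_0)
  next
    case False
    then have "[s ^ (p - 1) * s = 1 * s] (mod p)"
      using fermat_theorem assms cong_scalar_right by blast
    then show ?thesis
      using prime_gt_0_nat[OF assms] power_minus_mult[of p s] by simp
  qed
  have "r ^ (p ^ Suc k) = (r ^ (p ^ k)) ^ p"
    by (simp only: power_Suc2 power_mult)
  then show ?case using fermat[of "r ^ (p ^ k)"] Suc.IH cong_trans by metis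
qed simp

text \<open>The action of the group by conjugation on a normal subgroup of order \<open>p\<close> raises elements to an
  \<open>r\<close>-th power, and \<open>r \<equiv> r ^ (p ^ k) \<equiv> 1\<close> modulo \<open>p\<close> by Fermat.\<close>

lemma (in group) normal_order_p_central:
  assumes p: "Factorial_Ring.prime p" and ord: "order G = p ^ k" and fin: "finite (carrier G)"
    and z: "z \<in> carrier G" "ord z = p" and N: "generate G {z} \<lhd> G" and g: "g \<in> carrier G"
  shows "g \<otimes> z = z \<otimes> g"
proof -
  have "z \<in> generate G {z}" by (simp add: generate.incl)
  then have "g \<otimes> z \<otimes> inv g \<in> generate G {z}"
    using normal.inv_op_closed2[OF N g] by blast
  then obtain r :: nat where r: "g \<otimes> z \<otimes> inv g = z [^] r"
    using generate_pow_on_finite_carrier[OF fin z(1)] by auto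
  have step: "g [^] i \<otimes> z \<otimes> inv (g [^] i) = z [^] (r ^ i)" for i :: nat
  proof (induction i)
    case (Suc i)
    have "g \<otimes> z [^] j \<otimes> inv g = (z [^] r) [^] j" for j :: nat
      using int_pow_conj[of z "inv g" "int j"] r z g by (simp add: int_pow_int)
    then have "g \<otimes> (g [^] i \<otimes> z \<otimes> inv (g [^] i)) \<otimes> inv g = z [^] (r * r ^ i)"
      using Suc z by (simp add: nat_pow_pow)
    moreover have "g [^] Suc i = g \<otimes> g [^] i" using g nat_pow_Suc2 by simp
    ultimately show ?case using z g by (simp add: m_assoc inv_mult_group del: nat_pow_Suc)
  qed (use z in simp)
  have "g [^] (p ^ k) = \<one>" using pow_order_eq_1[OF g] ord by simp
  then have "z [^] (r ^ (p ^ k)) = z" using step[of "p ^ k"] z by simp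
  then have "z [^] int (r ^ (p ^ k)) = z [^] (1::int)" unfolding int_pow_int using z(1) by simp
  then have "int p dvd int 1 - int (r ^ (p ^ k))"
    using int_pow_eq[OF z(1)] z(2) by simp
  then have "[int (r ^ (p ^ k)) = int 1] (mod int p)"
    by (subst cong_sym_eq) (simp only: cong_iff_dvd_diff)
  then have "[r = 1] (mod p)"
    using fermat_power[OF p, of r k] unfolding cong_int_iff by (meson cong_sym cong_trans)
  then have "[int r = int 1] (mod int p)" by (simp only: cong_int_iff)
  then have "int p dvd int 1 - int r"
    by (subst (asm) cong_sym_eq) (simp only: cong_iff_dvd_diff)
  then have "z [^] int r = z [^] (1::int)"
    using int_pow_eq[OF z(1)] z(2) by simp
  then have "g \<otimes> z \<otimes> inv g = z" using r z by (simp add: int_pow_int)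
  then show ?thesis using z g by (simp add: inv_solve_right')
qed

text \<open>A maximal subgroup avoiding \<open>c [^] p\<close> would, together with the central element \<open>c [^] p\<close>,
  generate \<open>c\<close>, and hence contain a power \<open>c [^] (1 - p * i)\<close>, which generates the same cyclic group as \<open>c\<close>.\<close>

lemma (in group) pow_in_frattini:
  assumes D: "subgroup D G" and c: "c \<in> D"
    and central: "\<And>g. g \<in> carrier G \<Longrightarrow> g \<otimes> c [^] p = c [^] p \<otimes> g"
    and cpp: "(c [^] p) [^] p = \<one>"
  shows "c [^] (p::nat) \<in> frattini (G\<lparr>carrier := D\<rparr>)"
proof -
  define y where "y = c [^] p"
  have cG [simp]: "c \<in> carrier G" using subgroup.mem_carrier[OF D c] .
  have yG [simp]: "y \<in> carrier G" by (simp add: y_def)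
  have yD: "y [^] (i::int) \<in> D" for i
    using subgroup_int_pow_closed[OF D subgroup_int_pow_closed[OF D c, of "int p"], of i]
    unfolding y_def int_pow_int .
  have yc: "g \<otimes> y [^] (i::int) = y [^] i \<otimes> g" if "g \<in> carrier G" for g i
    using int_pow_commute[OF that yG central[OF that, folded y_def], of 1 i] that by simp
  have "y \<in> M" if M: "maximal_subgroup M (G\<lparr>carrier := D\<rparr>)" for M
  proof -
    have M': "subgroup M (G\<lparr>carrier := D\<rparr>)"
      and max: "\<And>K. subgroup K (G\<lparr>carrier := D\<rparr>) \<Longrightarrow> M \<subseteq> K \<Longrightarrow> K = M \<or> K = D"
      using M by (simp_all add: maximal_subgroup_def)
    have MD: "M \<subseteq> D" using subgroup.subset[OF M'] by simp
    have MG: "subgroup M G" by (rule incl_subgroup[OF D M'])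
    have Mc: "m \<in> carrier G" if "m \<in> M" for m using subgroup.mem_carrier[OF MG that] .
    \<comment> \<open>\<open>K\<close> is \<open>M\<close> times the cyclic group of the central
      \<open>y\<close>. Maximality leaves \<open>K = M\<close>, which contains \<open>y\<close>, or
      \<open>K = D\<close>, which contains \<open>c\<close>.\<close>
    define K where "K = {m \<otimes> y [^] i | m (i::int). m \<in> M}"
    have "subgroup K G"
    proof (rule subgroupI)
      show "K \<subseteq> carrier G" using Mc by (auto simp: K_def)
      show "K \<noteq> {}" using subgroup.one_closed[OF MG] by (auto simp: K_def)
    next
      fix k assume "k \<in> K"
      then obtain m i where k: "k = m \<otimes> y [^] (i::int)" "m \<in> M" by (auto simp: K_def)
      have "inv k = inv m \<otimes> y [^] (- i)"
        using k Mc yc[of "inv m" "- i"] by (simp add: inv_mult_group int_pow_neg)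
      then show "inv k \<in> K" using subgroup.m_inv_closed[OF MG k(2)] by (auto simp: K_def)
    next
      fix k k' assume "k \<in> K" "k' \<in> K"
      then obtain m i m' i' where k: "k = m \<otimes> y [^] (i::int)" "m \<in> M" "k' = m' \<otimes> y [^] (i'::int)" "m' \<in> M"
        by (auto simp: K_def)
      have "k \<otimes> k' = m \<otimes> m' \<otimes> y [^] (i + i')"
        using mult_mult_swap[of m "y [^] i" m' "y [^] i'"] k Mc yc[of m' i] by (simp add: int_pow_mult)
      then show "k \<otimes> k' \<in> K" using subgroup.m_closed[OF MG k(2,4)] by (auto simp: K_def)
    qed
    moreover have "K \<subseteq> D" using MD yD subgroup.m_closed[OF D] by (auto simp: K_def)
    ultimately have "subgroup K (G\<lparr>carrier := D\<rparr>)" by (rule subgroup_incl[OF _ D])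
    moreover have "M \<subseteq> K"
    proof
      fix m assume "m \<in> M"
      then have "m \<otimes> y [^] (0::int) \<in> K" unfolding K_def by blast
      then show "m \<in> K" using Mc[OF \<open>m \<in> M\<close>] by simp
    qed
    ultimately consider "K = M" | "K = D"
      using max by blast
    then show "y \<in> M"
    proof cases
      case 1
      have "\<one> \<otimes> y [^] (1::int) \<in> K" using subgroup.one_closed[OF MG] unfolding K_def by blast
      then show ?thesis using 1 by simp
    next
      case 2
      then obtain m i where m: "c = m \<otimes> y [^] (i::int)" "m \<in> M" using c by (auto simp: K_def)
      have yi: "y [^] i = c [^] (int p * i)" by (simp add: y_def int_pow_pow flip: int_pow_int)
      have "m = c \<otimes> inv (y [^] i)" using m Mc by (metis inv_solve_right int_pow_closed yG cG)
      also have "\<dots> = c [^] (1::int) \<otimes> c [^] (- (int p * i))" by (simp add: yi int_pow_neg)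
      also have "\<dots> = c [^] (1 - int p * i)" by (subst int_pow_mult[symmetric]) simp_all
      finally have cm: "c [^] (1 - int p * i) \<in> M" using m by simp
      have "coprime (1 - int p * i) (int p)"
      proof (rule coprimeI)
        fix q assume "q dvd 1 - int p * i" "q dvd int p"
        then have "q dvd (1 - int p * i) + int p * i" by (intro dvd_add) auto
        then show "is_unit q" by simp
      qed
      then have "coprime (1 - int p * i) (int (p * p))" by simp
      moreover have "c [^] (p * p) = \<one>" using cpp by (simp add: nat_pow_pow)
      ultimately have "c \<in> M" using mem_subgroup_of_coprime_pow[OF MG cG _ _ cm] by blast
      then show ?thesis
        using subgroup_int_pow_closed[OF MG, of c "int p"] by (simp add: y_def int_pow_int)
    qed
  qed
  moreover have "y \<in> D" using yD[of 1] by simp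
  ultimately show ?thesis by (auto simp: frattini_def y_def)
qed

text \<open>In the proof below, \<open>C\<close> consists of the elements commuting with \<open>y\<close> modulo the centre.\<close>

lemma (in group) derived_central:
  assumes gen: "\<And>K. subgroup K G \<Longrightarrow> a \<in> K \<Longrightarrow> b \<in> K \<Longrightarrow> z \<in> K \<Longrightarrow> K = carrier G"
    and cl [simp]: "a \<in> carrier G" "b \<in> carrier G" "c \<in> carrier G" "z \<in> carrier G"
    and ab: "a \<otimes> b = b \<otimes> a \<otimes> c"
    and cc: "\<And>g. g \<in> carrier G \<Longrightarrow> g \<otimes> c = c \<otimes> g"
    and zc: "\<And>g. g \<in> carrier G \<Longrightarrow> g \<otimes> z = z \<otimes> g"
    and "x \<in> derived G (carrier G)" "g \<in> carrier G"
  shows "g \<otimes> x = x \<otimes> g"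
proof -
  define Z where "Z = {x \<in> carrier G. \<forall>g\<in>carrier G. g \<otimes> x = x \<otimes> g}"
  have Z: "subgroup Z G"
  proof (rule subgroupI)
    show "Z \<subseteq> carrier G" "Z \<noteq> {}" by (auto simp: Z_def intro!: exI[of _ \<one>])
    show "inv x \<in> Z" if "x \<in> Z" for x
      using that int_pow_commute[of _ x 1 "- 1"] by (simp add: Z_def int_pow_neg)
    show "x \<otimes> y \<in> Z" if "x \<in> Z" "y \<in> Z" for x y
    proof -
      have xy: "x \<in> carrier G" "y \<in> carrier G" using that by (simp_all add: Z_def)
      have "g \<otimes> (x \<otimes> y) = x \<otimes> y \<otimes> g" if "g \<in> carrier G" for g
      proof -
        have gx: "g \<otimes> x = x \<otimes> g" and gy: "g \<otimes> y = y \<otimes> g"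
          using \<open>x \<in> Z\<close> \<open>y \<in> Z\<close> that by (simp_all add: Z_def)
        have "g \<otimes> (x \<otimes> y) = x \<otimes> g \<otimes> y"
          using xy that by (simp flip: m_assoc gx)
        then show ?thesis using xy that by (simp add: m_assoc gy)
      qed
      then show ?thesis using xy by (simp add: Z_def)
    qed
  qed
  have ZG: "v \<in> carrier G" if "v \<in> Z" for v using that by (simp add: Z_def)
  have Zc: "g \<otimes> v = v \<otimes> g" if "v \<in> Z" "g \<in> carrier G" for v g using that by (simp add: Z_def)
  define C where "C y = {x \<in> carrier G. \<exists>v\<in>Z. x \<otimes> y = y \<otimes> x \<otimes> v}" for y
  have Csub: "subgroup (C y) G" if y: "y \<in> carrier G" for y
  proof (rule subgroupI)
    show "C y \<subseteq> carrier G" by (auto simp: C_def)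
    show "C y \<noteq> {}" using y subgroup.one_closed[OF Z] by (auto simp: C_def intro!: exI[of _ \<one>] bexI[of _ \<one>])
  next
    fix x assume "x \<in> C y"
    then obtain v where x: "x \<in> carrier G" and v: "v \<in> Z" "x \<otimes> y = y \<otimes> x \<otimes> v" by (auto simp: C_def)
    have "x [^] (- 1 :: int) \<otimes> y = y \<otimes> x [^] (- 1 :: int) \<otimes> v [^] (- 1 :: int)"
      using int_pow_mult_central[of x y v "- 1"] x y v ZG Zc by blast
    then have "inv x \<otimes> y = y \<otimes> inv x \<otimes> inv v"
      using x v ZG by (simp add: int_pow_neg)
    then show "inv x \<in> C y" using x subgroup.m_inv_closed[OF Z v(1)] by (auto simp: C_def)
  next
    fix x x' assume "x \<in> C y" "x' \<in> C y"
    then obtain v v' where x: "x \<in> carrier G" "x' \<in> carrier G" and v: "v \<in> Z" "x \<otimes> y = y \<otimes> x \<otimes> v"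
      and v': "v' \<in> Z" "x' \<otimes> y = y \<otimes> x' \<otimes> v'" by (auto simp: C_def)
    have "x \<otimes> x' \<otimes> y = (x \<otimes> y) \<otimes> (x' \<otimes> v')"
      using x y v' ZG by (simp add: m_assoc)
    also have "\<dots> = y \<otimes> x \<otimes> v \<otimes> (x' \<otimes> v')" by (simp only: v(2))
    also have "\<dots> = y \<otimes> x \<otimes> x' \<otimes> (v \<otimes> v')"
      using mult_mult_swap[of "y \<otimes> x" v x' v'] x y v v' ZG Zc by simp
    finally have "x \<otimes> x' \<otimes> y = y \<otimes> (x \<otimes> x') \<otimes> (v \<otimes> v')"
      using x y v v' ZG by (simp add: m_assoc)
    then show "x \<otimes> x' \<in> C y" using x subgroup.m_closed[OF Z v(1) v'(1)] by (auto simp: C_def)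
  qed
  have Csym: "y \<in> C x" if "x \<in> C y" "y \<in> carrier G" for x y
  proof -
    obtain v where x: "x \<in> carrier G" and v: "v \<in> Z" "x \<otimes> y = y \<otimes> x \<otimes> v"
      using \<open>x \<in> C y\<close> by (auto simp: C_def)
    have "y \<otimes> x = x \<otimes> y \<otimes> inv v"
      using x v ZG \<open>y \<in> carrier G\<close> by (simp add: inv_solve_right)
    then show ?thesis using subgroup.m_inv_closed[OF Z v(1)] \<open>y \<in> carrier G\<close> by (auto simp: C_def)
  qed
  have self: "y \<in> C y" if "y \<in> carrier G" for y
    using that subgroup.one_closed[OF Z] by (auto simp: C_def intro!: bexI[of _ \<one>])
  have zC: "z \<in> C y" if "y \<in> carrier G" for y
    using that subgroup.one_closed[OF Z] zc[OF that] by (auto simp: C_def intro!: bexI[of _ \<one>])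
  have "c \<in> Z" using cc by (simp add: Z_def)
  then have "a \<in> C b" unfolding C_def using ab cl(1) by blast
  \<comment> \<open>\<open>C b\<close> contains \<open>a\<close>, \<open>b\<close> and
    \<open>z\<close>; symmetry gives \<open>b \<in> C a\<close>. Once both are the whole group,
    symmetry puts \<open>a\<close> and \<open>b\<close> into every \<open>C y\<close>.\<close>
  then have "C b = carrier G" "C a = carrier G"
    using gen[OF Csub] self zC Csym by auto
  then have "C y = carrier G" if "y \<in> carrier G" for y
    using gen[OF Csub] zC Csym that by auto
  then have "derived_set G (carrier G) \<subseteq> Z"
  proof -
    assume all: "\<And>y. y \<in> carrier G \<Longrightarrow> C y = carrier G"
    have "x \<otimes> y \<otimes> inv x \<otimes> inv y \<in> Z" if xy: "x \<in> carrier G" "y \<in> carrier G" for x y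
    proof -
      obtain v where v: "v \<in> Z" "x \<otimes> y = y \<otimes> x \<otimes> v" using all[OF xy(2)] xy(1) by (auto simp: C_def)
      have "x \<otimes> y \<otimes> inv x \<otimes> inv y = v \<otimes> (y \<otimes> x) \<otimes> inv x \<otimes> inv y"
        using Zc[OF v(1), of "y \<otimes> x"] v xy by simp
      also have "\<dots> = v" using xy ZG[OF v(1)] by (simp add: m_assoc)
      finally show ?thesis using v by simp
    qed
    then show ?thesis by auto
  qed
  then have "derived G (carrier G) \<subseteq> Z"
    unfolding derived_def using generate_subgroup_incl Z by blast
  then show ?thesis using assms by (auto simp: Z_def)
qed

section \<open>The theorem\<close>

text \<open>\<open>z\<close> is replaced by \<open>z [^] w\<close>, the commutator of
  \<open>c\<close> and \<open>a\<close>; an inverse of \<open>w\<close> modulo \<open>p\<close>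
  rewrites powers of \<open>z\<close> as powers of the new element.\<close>

lemma (in group) class3_groupI:
  assumes fin: "finite (carrier G)" and p: "Factorial_Ring.prime p"
    and cl: "a \<in> carrier G" "b \<in> carrier G" "c \<in> carrier G" "z \<in> carrier G"
    and rels: "a \<otimes> b = b \<otimes> a \<otimes> c" "c \<otimes> a = a \<otimes> c \<otimes> z [^] (w::int)" "c \<otimes> b = b \<otimes> c"
    and central: "\<And>g. g \<in> carrier G \<Longrightarrow> g \<otimes> z = z \<otimes> g"
    and ord: "ord z = p" and w: "\<not> int p dvd w" and c_p: "c [^] p = \<one>"
    and pows: "a [^] (p ^ \<alpha>) = z [^] (e::int)" "b [^] (p ^ \<beta>) = z [^] (f::int)"
    and gen: "\<And>K. subgroup K G \<Longrightarrow> a \<in> K \<Longrightarrow> b \<in> K \<Longrightarrow> z \<in> K \<Longrightarrow> K = carrier G"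
    and ge: "p ^ (\<alpha> + \<beta> + 2) \<le> order G"
  shows "class3_group G a b c (z [^] w) p \<alpha> \<beta>"
proof -
  have z_p: "z [^] p = \<one>" using ord pow_ord_eq_1[OF cl(4)] by simp
  have cop: "coprime w (int p)"
    using w p by (metis prime_imp_coprime coprime_commute prime_nat_int_transfer)
  then obtain v where v: "[w * v = 1] (mod int p)" using cong_solve_coprime_int by blast
  have zw: "z [^] (k::int) = (z [^] w) [^] (v * k)" for k
  proof -
    have "[w * v * k = 1 * k] (mod int p)" using v cong_scalar_right by blast
    then have "z [^] (w * (v * k)) = z [^] k"
      using int_pow_mod[OF cl(4) z_p] by (metis cong_def mult.assoc mult_1)
    then show ?thesis using cl by (simp add: int_pow_pow)
  qed
  show ?thesis
  proof (unfold_locales)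
    show "g \<otimes> z [^] w = z [^] w \<otimes> g" if "g \<in> carrier G" for g
      using int_pow_commute[OF that cl(4) central[OF that], of 1 w] that by simp
    show "z [^] w \<noteq> \<one>" using int_pow_eq_id[OF cl(4)] ord w by simp
    have "z [^] (w * int p) = \<one>" using int_pow_eq_id[OF cl(4)] ord by simp
    then show "(z [^] w) [^] p = \<one>" using cl by (simp add: int_pow_int flip: int_pow_pow)
    show "\<exists>e::int. a [^] (p ^ \<alpha>) = (z [^] w) [^] e" using pows(1) zw by metis
    show "\<exists>e::int. b [^] (p ^ \<beta>) = (z [^] w) [^] e" using pows(2) zw by metis
    show "K = carrier G" if K: "subgroup K G" "a \<in> K" "b \<in> K" "z [^] w \<in> K" for K
      using gen[OF K(1-3)] mem_subgroup_of_coprime_pow[OF K(1) cl(4) z_p cop K(4)] .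
  qed (use assms in auto)
qed

lemma (in group) class_A_of_structure:
  assumes fin: "finite (carrier G)" and p: "Factorial_Ring.prime p"
    and cl: "a \<in> carrier G" "b \<in> carrier G" "z \<in> carrier G"
    and c_def: "c = commutator G a b"
    and w12: "commutator G c a = z [^] (w12::int)" and w22: "commutator G c b = z [^] (w22::int)"
    and central: "\<And>g. g \<in> carrier G \<Longrightarrow> g \<otimes> z = z \<otimes> g"
    and ord: "ord z = p" and c_p: "c [^] p = \<one>"
    and G3: "G3 G = generate G {z}"
    and pows: "a [^] (p ^ n) = z [^] (w11::int)" "b [^] (p ^ m) = z [^] (w21::int)"
    and gen: "\<And>K. subgroup K G \<Longrightarrow> a \<in> K \<Longrightarrow> b \<in> K \<Longrightarrow> z \<in> K \<Longrightarrow> K = carrier G"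
    and ge: "p ^ (n + m + 2) \<le> order G"
    and nm: "1 \<le> m" "m \<le> n" "p = 2 \<longrightarrow> n > 1"
  shows "p = 2 \<Longrightarrow> m = 1 \<Longrightarrow> class_A p 3 G"
    and "(p = 2 \<longrightarrow> m > 1) \<Longrightarrow> int p dvd w22 \<Longrightarrow> \<not> int p dvd w12 \<Longrightarrow> class_A p (m + 1) G"
    and "(p = 2 \<longrightarrow> m > 1) \<Longrightarrow> \<not> int p dvd w22 \<Longrightarrow> int p dvd w12 \<Longrightarrow> class_A p (n + 1) G"
proof -
  have c [simp]: "c \<in> carrier G" using cl by (simp add: c_def)
  note cl [simp]
  have ab: "a \<otimes> b = b \<otimes> a \<otimes> c" using commutator_eq[OF cl(1,2)] unfolding c_def .
  have ca: "c \<otimes> a = a \<otimes> c \<otimes> z [^] w12" using commutator_eq[OF c cl(1)] unfolding w12 .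
  have cb: "c \<otimes> b = b \<otimes> c \<otimes> z [^] w22" using commutator_eq[OF c cl(2)] unfolding w22 .
  have z_pow: "z [^] k = \<one> \<longleftrightarrow> int p dvd k" for k :: int
    using int_pow_eq_id[OF cl(3)] ord by simp
  have zc: "g \<otimes> z [^] k = z [^] k \<otimes> g" if "g \<in> carrier G" for g and k :: int
    using int_pow_commute[OF that cl(3) central[OF that], of 1 k] that by simp
  have locale1: "class3_group G a b c (z [^] w12) p n m" if w: "int p dvd w22" "\<not> int p dvd w12"
  proof (rule class3_groupI[OF fin p cl(1,2) c cl(3) ab ca _ central ord w(2) c_p pows gen ge])
    show "c \<otimes> b = b \<otimes> c" using cb z_pow w(1) by simp
  qed
  show "class_A p 3 G" if p2: "p = 2" and m: "m = 1"
  proof -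
    have "b [^] (2::nat) = z [^] w21" using pows(2) p2 m by simp
    then have bb: "b \<otimes> b = z [^] w21" by (simp add: numeral_2_eq_2)
    have "c [^] (2::nat) = \<one>" using c_p p2 by simp
    then have cc: "c \<otimes> c = \<one>" by (simp add: numeral_2_eq_2)
    \<comment> \<open>Moving \<open>a\<close> past \<open>b\<close> twice produces
      \<open>c \<otimes> c = \<one>\<close> and one factor \<open>z [^] w22\<close>. As
      \<open>b \<otimes> b\<close> is central, this factor is trivial.\<close>
    have "a \<otimes> (b \<otimes> b) = b \<otimes> a \<otimes> c \<otimes> b" using ab by (simp flip: m_assoc)
    also have "\<dots> = b \<otimes> a \<otimes> (b \<otimes> c \<otimes> z [^] w22)" using cb by (simp add: m_assoc)
    also have "\<dots> = b \<otimes> (a \<otimes> b) \<otimes> c \<otimes> z [^] w22" by (simp add: m_assoc)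
    also have "\<dots> = b \<otimes> b \<otimes> a \<otimes> (c \<otimes> c) \<otimes> z [^] w22" unfolding ab by (simp add: m_assoc)
    also have "\<dots> = a \<otimes> (b \<otimes> b) \<otimes> z [^] w22" using zc[OF cl(1), of w21] by (simp add: cc bb)
    finally have "z [^] w22 = \<one>"
      using l_cancel_one'[of "a \<otimes> (b \<otimes> b)" "z [^] w22"] by simp
    then have w22': "int p dvd w22" using z_pow by simp
    \<comment> \<open>If both exponents were divisible by \<open>p\<close>, then \<open>c\<close>
      and with it the whole derived subgroup would be central, and \<open>G3 G\<close> would be
      trivial.\<close>
    have "\<not> int p dvd w12"
    proof
      assume "int p dvd w12"
      then have z1: "z [^] w12 = \<one>" "z [^] w22 = \<one>" using z_pow w22' by simp_all
      define K where "K = {g \<in> carrier G. g \<otimes> c = c \<otimes> g}"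
      have "subgroup K G"
      proof (rule subgroupI)
        show "K \<subseteq> carrier G" by (auto simp: K_def)
        have "\<one> \<in> K" by (simp add: K_def)
        then show "K \<noteq> {}" by blast
        show "inv x \<in> K" if "x \<in> K" for x
          using that int_pow_commute[of x c "- 1" 1] by (simp add: K_def int_pow_neg)
        show "x \<otimes> y \<in> K" if "x \<in> K" "y \<in> K" for x y
        proof -
          have xy: "x \<in> carrier G" "y \<in> carrier G" "x \<otimes> c = c \<otimes> x" "y \<otimes> c = c \<otimes> y"
            using that by (simp_all add: K_def)
          have "x \<otimes> y \<otimes> c = x \<otimes> (c \<otimes> y)" using xy by (simp add: m_assoc)
          also have "\<dots> = c \<otimes> (x \<otimes> y)" using xy by (simp flip: m_assoc)
          finally show ?thesis using xy by (simp add: K_def)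
        qed
      qed
      moreover have "a \<in> K" "b \<in> K" "z \<in> K"
        using ca cb z1 central[OF c] by (simp_all add: K_def)
      ultimately have "K = carrier G" by (rule gen)
      then have cc: "g \<otimes> c = c \<otimes> g" if "g \<in> carrier G" for g
        using that by (auto simp: K_def)
      have "commutator G x g = \<one>" if "x \<in> derived G (carrier G)" "g \<in> carrier G" for x g
      proof -
        have x: "x \<in> carrier G" using that(1) derived_in_carrier by blast
        have "g \<otimes> x = x \<otimes> g"
          by (rule derived_central[OF gen cl(1,2) c cl(3) ab cc central that])
        then have "g \<otimes> x \<otimes> commutator G x g = g \<otimes> x"
          using commutator_eq[OF x that(2)] by simp
        then show ?thesis using x that(2) by simp
      qed
      then have "{commutator G x y |x y. x \<in> derived G (carrier G) \<and> y \<in> carrier G} \<subseteq> {\<one>}"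
        by auto
      then have "generate G {z} \<subseteq> {\<one>}"
        unfolding G3[symmetric] G3_def commutator_subgroup_def
        using generate_subgroup_incl triv_subgroup by blast
      then have "z = \<one>" using generate.incl[of z "{z}" G] by blast
      then show False using ord ord_eq_1[OF cl(3)] p by auto
    qed
    from locale1[OF w22' this] show ?thesis
      using class3_group.class_A_two p2 m nm by fastforce
  qed
  show "class_A p (m + 1) G" if "p = 2 \<longrightarrow> m > 1" "int p dvd w22" "\<not> int p dvd w12"
    using class3_group.class_A_generic[OF locale1[OF that(2,3)]] that(1) nm by auto
  show "class_A p (n + 1) G" if m: "p = 2 \<longrightarrow> m > 1" and w: "\<not> int p dvd w22" "int p dvd w12"
  proof -
    \<comment> \<open>Exchanging \<open>a\<close> and \<open>b\<close> inverts their commutator,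
      hence \<open>inv c\<close> and \<open>- w22\<close>; now \<open>n\<close> takes the place of
      \<open>\<beta>\<close> and gives the index \<open>p ^ n\<close>.\<close>
    have "class3_group G b a (inv c) (z [^] (- w22)) p m n"
    proof (rule class3_groupI[OF fin p cl(2,1) _ cl(3) _ _ _ central ord _ _ pows(2,1) gen])
      show "b \<otimes> a = a \<otimes> b \<otimes> inv c" using ab by (simp add: m_assoc)
      show "inv c \<otimes> b = b \<otimes> inv c \<otimes> z [^] (- w22)"
        using int_pow_swap_central[OF c cl(2) _ zc cb, of "- 1" 1] by (simp add: int_pow_neg int_pow_pow)
      have "c \<otimes> a = a \<otimes> c" using ca z_pow w(2) by simp
      then show "inv c \<otimes> a = a \<otimes> inv c"
        using int_pow_commute[OF c cl(1), of "- 1" 1] by (simp add: int_pow_neg)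
      show "inv c [^] p = \<one>" using c_p by (simp add: nat_pow_inv)
      show "p ^ (m + n + 2) \<le> order G" using ge by (simp add: add.commute)
    qed (use w in auto)
    from class3_group.class_A_generic[OF this] show ?thesis using nm m by auto
  qed
qed

theorem theorem4p2:
  fixes G :: "('g, 'x) monoid_scheme" and p n m :: nat and w :: "int ^ 2 ^ 2"
  assumes "Factorial_Ring.prime p"
    and "p_group p G"
    and "G\<lparr>carrier := G3 G\<rparr> \<cong> integer_mod_group p"
    and "frattini (G\<lparr>carrier := derived G (carrier G)\<rparr>) = {\<one>\<^bsub>G\<^esub>}"
    and "G Mod G3 G \<cong> Mp_group p n m"
    and "1 \<le> m" and "m \<le> n" and "p = 2 \<longrightarrow> n > 1"
    and "characteristic_matrix p n m G w"
  shows "(p = 2 \<and> m = 1 \<longrightarrow> class_A p 3 G) \<and>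
         ((p = 2 \<longrightarrow> m > 1) \<longrightarrow>
            w $ 2 $ 2 = \<zero>\<^bsub>residue_ring (int p)\<^esub> \<and> w $ 1 $ 2 \<noteq> \<zero>\<^bsub>residue_ring (int p)\<^esub> \<longrightarrow>
            class_A p (m + 1) G) \<and>
         ((p = 2 \<longrightarrow> m > 1) \<longrightarrow>
            w $ 2 $ 2 \<noteq> \<zero>\<^bsub>residue_ring (int p)\<^esub> \<and> w $ 1 $ 2 = \<zero>\<^bsub>residue_ring (int p)\<^esub> \<longrightarrow>
            class_A p (n + 1) G)"
proof -
  note p = assms(1)
  have fin: "finite (carrier G)" using assms(2) by (simp add: p_group_def)
  obtain k where k: "order G = p ^ k" using assms(2) by (auto simp: p_group_def)
  interpret group G using assms(2) by (simp add: p_group_def)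
  define N where "N = G3 G"
  interpret N: normal N G unfolding N_def by (rule G3_normal)
  define Q where "Q = G Mod N"
  interpret Q: group Q unfolding Q_def by (rule N.factorgroup_is_group)
  define q where "q = (\<lambda>x. N #>\<^bsub>G\<^esub> x)"
  interpret q: group_hom G Q q
    using N.r_coset_hom_Mod by unfold_locales (simp add: Q_def q_def)
  obtain a b z where a: "a \<in> carrier G" and b: "b \<in> carrier G" and z: "z \<in> carrier G"
    and genQ: "generate Q {q a, q b} = carrier Q"
    and cpQ: "commutator Q (q a) (q b) [^]\<^bsub>Q\<^esub> p = \<one>\<^bsub>Q\<^esub>"
    and Nz: "N = generate G {z}"
    and w: "\<And>i j. w $ i $ j \<in> carrier (residue_ring (int p))"
    and ap: "a [^]\<^bsub>G\<^esub> (p ^ n) = z [^]\<^bsub>G\<^esub> (w $ 1 $ 1)" and bp: "b [^]\<^bsub>G\<^esub> (p ^ m) = z [^]\<^bsub>G\<^esub> (w $ 2 $ 1)"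
    and w12: "commutator G (commutator G a b) a = z [^]\<^bsub>G\<^esub> (w $ 1 $ 2)"
    and w22: "commutator G (commutator G a b) b = z [^]\<^bsub>G\<^esub> (w $ 2 $ 2)"
    using assms(9) unfolding characteristic_matrix_def Let_def N_def[symmetric] Q_def[symmetric] q_def
    by blast
  define c where "c = commutator G a b"
  have c: "c \<in> carrier G" using a b by (simp add: c_def)
  have cardN: "card N = p"
    using iso_same_card[OF assms(3)] prime_gt_0_nat[OF p]
    by (simp add: N_def carrier_integer_mod_group)
  then have ord: "ord z = p" using generate_pow_card[OF z] Nz by simp
  have central: "g \<otimes>\<^bsub>G\<^esub> z = z \<otimes>\<^bsub>G\<^esub> g" if "g \<in> carrier G" for g
    using normal_order_p_central[OF p k fin z ord _ that] N.normal_axioms Nz by simp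
  have qN: "x \<in> N" if "x \<in> carrier G" "q x = \<one>\<^bsub>Q\<^esub>" for x
    using that rcos_self[OF that(1) N.subgroup_axioms] by (simp add: Q_def q_def)
  \<comment> \<open>The quotient only shows that \<open>c\<close> to the power \<open>p\<close> is a
    power of \<open>z\<close>. Being central and killed by \<open>p\<close>, it lies in the Frattini
    subgroup of the derived subgroup, which is trivial.\<close>
  have cpN: "c [^]\<^bsub>G\<^esub> p \<in> N"
  proof (rule qN)
    show "q (c [^]\<^bsub>G\<^esub> p) = \<one>\<^bsub>Q\<^esub>"
      using cpQ q.hom_nat_pow[OF c, of p] q.hom_commutator[OF a b] by (simp add: c_def)
  qed (use c in simp)
  then obtain j :: int where j: "c [^]\<^bsub>G\<^esub> p = z [^]\<^bsub>G\<^esub> j" using generate_pow[OF z] Nz by auto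
  have "c [^]\<^bsub>G\<^esub> p \<in> frattini (G\<lparr>carrier := derived G (carrier G)\<rparr>)"
  proof (rule pow_in_frattini)
    show "subgroup (derived G (carrier G)) G" by (rule derived_is_subgroup) simp
    show "c \<in> derived G (carrier G)" unfolding c_def by (rule commutator_in_derived[OF a b])
    show "g \<otimes>\<^bsub>G\<^esub> c [^]\<^bsub>G\<^esub> p = c [^]\<^bsub>G\<^esub> p \<otimes>\<^bsub>G\<^esub> g" if "g \<in> carrier G" for g
      using int_pow_commute[OF that z central[OF that], of 1 j] that j by simp
    have "z [^]\<^bsub>G\<^esub> (j * int p) = \<one>\<^bsub>G\<^esub>" using int_pow_eq_id[OF z] ord by simp
    then show "(c [^]\<^bsub>G\<^esub> p) [^]\<^bsub>G\<^esub> p = \<one>\<^bsub>G\<^esub>" using z j by (simp add: int_pow_int flip: int_pow_pow)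
  qed
  then have c_p: "c [^]\<^bsub>G\<^esub> p = \<one>\<^bsub>G\<^esub>" using assms(4) by simp
  \<comment> \<open>Such a \<open>K\<close> contains the kernel \<open>N\<close> of \<open>q\<close>
    and maps onto the quotient.\<close>
  have gen: "K = carrier G" if K: "subgroup K G" "a \<in> K" "b \<in> K" "z \<in> K" for K
  proof
    show "K \<subseteq> carrier G" using subgroup.subset[OF K(1)] .
    have NK: "N \<subseteq> K" unfolding Nz using K by (intro generate_subgroup_incl) auto
    have "generate Q {q a, q b} \<subseteq> q ` K"
      using K q.subgroup_img_is_subgroup[OF K(1)] by (intro Q.generate_subgroup_incl) auto
    then have QK: "carrier Q \<subseteq> q ` K" using genQ by simp
    show "carrier G \<subseteq> K"
    proof
      fix g assume g: "g \<in> carrier G"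
      then have "q g \<in> q ` K" using QK by auto
      then obtain x where x: "x \<in> K" "q g = q x" by auto
      have "g \<in> N #>\<^bsub>G\<^esub> x" using rcos_self[OF g N.subgroup_axioms] x(2) by (simp add: q_def)
      then obtain y where "y \<in> N" "g = y \<otimes>\<^bsub>G\<^esub> x" by (auto simp: r_coset_def)
      then show "g \<in> K" using subgroup.m_closed[OF K(1)] NK x(1) by auto
    qed
  qed
  have finQ: "finite (carrier Q)"
    using fin by (simp add: Q_def carrier_FactGroup)
  have QMp: "Q \<cong> Mp_group p n m" using assms(5) by (simp add: Q_def N_def)
  have "finite (carrier (Mp_group p n m))"
    using QMp finQ bij_betw_finite unfolding is_iso_def iso_def by blast
  then have "p ^ (n + m + 1) \<le> card (carrier Q)"
    using card_Mp_group_ge[of p n m] iso_same_card[OF QMp] assms(6,7) by simp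
  then have "p ^ (n + m + 1) * p \<le> card (rcosets\<^bsub>G\<^esub> N) * card N"
    using cardN by (simp add: Q_def FactGroup_def)
  then have ge: "p ^ (n + m + 2) \<le> order G"
    using lagrange[OF N.subgroup_axioms] by (simp add: mult.commute)
  \<comment> \<open>The entries lie between \<open>0\<close> and \<open>p - 1\<close>, so
    divisibility by \<open>p\<close> means being zero.\<close>
  have dvd: "int p dvd w $ i $ j \<longleftrightarrow> w $ i $ j = \<zero>\<^bsub>residue_ring (int p)\<^esub>" for i j
    using w[of i j] by (auto simp: residue_ring_def dest: zdvd_imp_le)
  note struct = class_A_of_structure[OF fin p a b z c_def w12[folded c_def] w22[folded c_def] central ord c_p
      Nz[unfolded N_def] ap bp gen ge assms(6-8)]
  show ?thesis
    using struct unfolding dvd by blast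
qed

end
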